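(* Let $\mathbb K$ be $\mathbb H$ or $\mathbb O$, let $\Omega\subseteq\mathbb K$ be a slice domain, and let $f:\Omega\to\mathbb K^2$ be a slice regular curve. If $f$ is injective, then $f(\Omega)$ is a parameterized hypercomplex Riemann manifold in $\mathbb K^2$, and the map $f:\Omega\to f(\Omega)$ is a slice conformal parameterization. In particular, graphs $\{(q,g(q)):q\in\Omega\}$ of slice regular functions $g:\Omega\to\mathbb K$ are parameterized hypercomplex Riemann manifolds in $\mathbb K^2$.
   Context: $\mathbb K$ is the division algebra of quaternions $\mathbb H$ or octonions $\mathbb O$, identified with $\mathbb R^{\dim\mathbb K}$ ($\dim\mathbb K=4$ or $8$) with the Euclidean scalar product. $\mathbb S=\{I\in\mathbb K: I^2=-1\}$. For $I\in\mathbb S$, $\mathbb C_I=\mathbb R+I\mathbb R$ and $\mathbb C_I^\perp$ is its orthogonal complement in $\mathbb K$. $\mathbb K^2$ is regarded as $\mathbb R^{2\dim\mathbb K}$. A slice domain $\Omega\subseteq\mathbb K$ is an open connected set containing real points such that $\Omega_I=\Omega\cap\mathbb C_I$ is a domain of $\mathbb C_I$ for each $I\in\mathbb S$. A function $g:\Omega\to\mathbb K$ is slice regular if for every $I\in\mathbb S$ the restriction $g_I=g_{|\Omega_I}$ has continuous partial derivatives and $\frac12\left(\frac{\partial}{\partial x}+I\frac{\partial}{\partial y}\right)g_I(x+yI)\equiv0$ on $\Omega_I$. A slice regular curve in $\mathbb K^2$ is a map $f=(g,h):\Omega\to\mathbb K^2$ whose components $g,h$ are slice regular and which is an immersion (its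 real differential is injective at every point). A linear map $T$ from an $n$-dimensional Euclidean space to $\mathbb R^N$ is conformal if $T^tT=k\,\mathrm{Id}$ with $k\ne0$. A $C^1$ map $f:\Omega\to\mathbb R^N$ ($N\ge\dim\mathbb K$) is slice conformal if for all $I\in\mathbb S$ and all $x+Iy\in\Omega$ both $df(x+Iy)_{|\mathbb C_I}$ and $df(x+Iy)_{|\mathbb C_I^\perp}$ are conformal. A slice conformal (slice isothermal) parameterization is a slice conformal map that is an injective immersion; its image is called a parameterized hypercomplex Riemann manifold of $\mathbb R^N$. *)

theory Defs
  imports "HOL-Analysis.Analysis"
begin

section \<open>Quaternions and octonions by Cayley-Dickson doubling\<close>

class conj =
  fixes conj :: "'a \<Rightarrow> 'a"

instantiation complex :: conj
begin
definition conj_complex_def [simp]: "conj z = cnj z"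
instance ..
end

datatype 'a cd = CD (cd_fst: 'a) (cd_snd: 'a)

lemma cd_eq_iff: "x = y \<longleftrightarrow> cd_fst x = cd_fst y \<and> cd_snd x = cd_snd y"
  by (cases x; cases y) auto

instantiation cd :: (ab_group_add) ab_group_add
begin
definition "0 = CD 0 0"
definition "x + y = CD (cd_fst x + cd_fst y) (cd_snd x + cd_snd y)"
definition "- x = CD (- cd_fst x) (- cd_snd x)"
definition "x - y = CD (cd_fst x - cd_fst y) (cd_snd x - cd_snd y)"
instance
  by standard (auto simp: zero_cd_def plus_cd_def uminus_cd_def minus_cd_def)
end

instantiation cd :: (real_vector) real_vector
begin
definition "r *\<^sub>R x = CD (r *\<^sub>R cd_fst x) (r *\<^sub>R cd_snd x)"
instance
  by standard (simp_all add: scaleR_cd_def plus_cd_def algebra_simps)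
end

instantiation cd :: (real_inner) real_inner
begin
definition "inner (x :: 'a cd) y = inner (cd_fst x) (cd_fst y) + inner (cd_snd x) (cd_snd y)"
definition "norm (x :: 'a cd) = sqrt (inner x x)"
definition "sgn (x :: 'a cd) = x /\<^sub>R norm x"
definition "dist (x :: 'a cd) y = norm (x - y)"
definition "(uniformity :: ('a cd \<times> 'a cd) filter) =
  (INF e\<in>{0 <..}. principal {(x, y). dist x y < e})"
definition "open (U :: 'a cd set) \<longleftrightarrow>
  (\<forall>x\<in>U. eventually (\<lambda>(x', y). x' = x \<longrightarrow> y \<in> U) uniformity)"
instance
proof
  fix x y z :: "'a cd" and r :: real
  show "inner x y = inner y x"
    by (simp add: inner_cd_def inner_commute)
  show "inner (x + y) z = inner x z + inner y z"
    by (simp add: inner_cd_def plus_cd_def inner_add_left)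
  show "inner (r *\<^sub>R x) y = r * inner x y"
    by (simp add: inner_cd_def scaleR_cd_def distrib_left)
  show "0 \<le> inner x x"
    by (simp add: inner_cd_def)
  show "inner x x = 0 \<longleftrightarrow> x = 0"
    by (simp add: inner_cd_def zero_cd_def cd_eq_iff add_nonneg_eq_0_iff)
qed (rule sgn_cd_def dist_cd_def uniformity_cd_def open_cd_def norm_cd_def)+
end

instantiation cd :: (euclidean_space) euclidean_space
begin
definition "Basis = (\<lambda>u. CD u 0) ` Basis \<union> (\<lambda>v. CD 0 v) ` Basis"
instance
proof
  show "(Basis :: 'a cd set) \<noteq> {}" "finite (Basis :: 'a cd set)"
    by (auto simp: Basis_cd_def)
  fix u v :: "'a cd"
  show "inner u v = (if u = v then 1 else 0)" if "u \<in> Basis" "v \<in> Basis"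
    using that by (auto simp: Basis_cd_def inner_cd_def inner_Basis split: if_splits)
  show "(\<forall>v\<in>Basis. inner u v = 0) \<longleftrightarrow> u = 0"
    by (auto simp: Basis_cd_def inner_cd_def ball_Un zero_cd_def cd_eq_iff
      euclidean_all_zero_iff)
qed
end

instantiation cd :: ("{conj, uminus}") conj
begin
definition "conj x = CD (conj (cd_fst x)) (- cd_snd x)"
instance ..
end

instantiation cd :: ("{zero, one}") one
begin
definition "1 = CD 1 0"
instance ..
end

instantiation cd :: ("{conj, times, plus, minus}") times
begin
definition "x * y = CD
  (cd_fst x * cd_fst y - conj (cd_snd y) * cd_snd x)
  (cd_snd y * cd_fst x + cd_snd x * conj (cd_fst y))"
instance ..
end

type_synonym quat = "complex cd"
type_synonym octo = "quat cd"

lemma DIM_cd: "DIM('a::euclidean_space cd) = 2 * DIM('a)"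
proof -
  have "inj_on (\<lambda>u::'a. CD u 0) Basis" "inj_on (CD (0::'a)) Basis"
    by (auto intro: inj_onI)
  moreover have "(\<lambda>u::'a. CD u 0) ` Basis \<inter> CD 0 ` Basis = {}"
    by auto
  ultimately show ?thesis
    by (simp add: Basis_cd_def card_Un_disjoint card_image)
qed

lemma DIM_quat: "DIM(quat) = 4" and DIM_octo: "DIM(octo) = 8"
  by (simp_all add: DIM_cd)

text \<open>Sanity checks: on both algebras the Euclidean norm is multiplicative.\<close>

lemmas cd_arith = times_cd_def plus_cd_def minus_cd_def uminus_cd_def zero_cd_def
  one_cd_def conj_cd_def inner_cd_def

lemma norm_mult_quat: "norm (x * y) = norm x * norm (y :: quat)"
proof -
  have "inner (x * y) (x * y) = inner x x * inner y y"
    by (simp add: cd_arith inner_complex_def algebra_simps)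
  then show ?thesis
    by (simp add: norm_eq_sqrt_inner real_sqrt_mult)
qed

lemma norm_mult_octo: "norm (x * y) = norm x * norm (y :: octo)"
proof -
  have "inner (x * y) (x * y) = inner x x * inner y y"
    by (simp add: cd_arith inner_complex_def) algebra
  then show ?thesis
    by (simp add: norm_eq_sqrt_inner real_sqrt_mult)
qed

section \<open>Slice regular functions and curves\<close>

text \<open>Octonions do not form an associative ring, so they are not an instance of
  \<^class>\<open>real_algebra_1\<close>. Hence the notions below are stated over the sort
  \<open>{euclidean_space, one, times}\<close>, and the real number \<open>r\<close> is rendered as \<open>r *\<^sub>R 1\<close>.\<close>

definition imag_units :: "'a::{euclidean_space, one, times} set" where
  "imag_units = {I. I * I = - 1}"

definition slice_point :: "'a::{euclidean_space, one, times} \<Rightarrow> real \<Rightarrow> real \<Rightarrow> 'a" where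
  "slice_point I x y = x *\<^sub>R 1 + y *\<^sub>R I"

definition slice_plane :: "'a::{euclidean_space, one, times} \<Rightarrow> 'a set" where
  "slice_plane I = {slice_point I x y | x y. True}"

definition slice_domain :: "'a::{euclidean_space, one, times} set \<Rightarrow> bool" where
  "slice_domain \<Omega> \<longleftrightarrow>
     open \<Omega> \<and> connected \<Omega> \<and> (\<exists>r. r *\<^sub>R 1 \<in> \<Omega>) \<and>
     (\<forall>I\<in>imag_units.
        openin (top_of_set (slice_plane I)) (\<Omega> \<inter> slice_plane I) \<and>
        connected (\<Omega> \<inter> slice_plane I) \<and> \<Omega> \<inter> slice_plane I \<noteq> {})"

text \<open>\<open>gx\<close> and \<open>gy\<close> are the partial derivatives of the restriction of \<open>g\<close> to the slice of \<open>I\<close>.\<close>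

definition slice_regular_on ::
    "'a::{euclidean_space, one, times} set \<Rightarrow> ('a \<Rightarrow> 'a) \<Rightarrow> bool" where
  "slice_regular_on \<Omega> g \<longleftrightarrow>
     (\<forall>I\<in>imag_units. \<exists>gx gy.
        continuous_on (\<Omega> \<inter> slice_plane I) gx \<and>
        continuous_on (\<Omega> \<inter> slice_plane I) gy \<and>
        (\<forall>x y. slice_point I x y \<in> \<Omega> \<longrightarrow>
           ((\<lambda>t. g (slice_point I t y)) has_vector_derivative gx (slice_point I x y)) (at x) \<and>
           ((\<lambda>t. g (slice_point I x t)) has_vector_derivative gy (slice_point I x y)) (at y) \<and>
           (1/2) *\<^sub>R (gx (slice_point I x y) + I * gy (slice_point I x y)) = 0))"

definition immersion_on ::
    "'a::euclidean_space set \<Rightarrow> ('a \<Rightarrow> 'b::euclidean_space) \<Rightarrow> bool" where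
  "immersion_on \<Omega> f \<longleftrightarrow>
     (\<forall>q\<in>\<Omega>. f differentiable (at q) \<and> inj (frechet_derivative f (at q)))"

definition slice_regular_curve ::
    "'a::{euclidean_space, one, times} set \<Rightarrow> ('a \<Rightarrow> 'a \<times> 'a) \<Rightarrow> bool" where
  "slice_regular_curve \<Omega> f \<longleftrightarrow>
     slice_regular_on \<Omega> (\<lambda>q. fst (f q)) \<and> slice_regular_on \<Omega> (\<lambda>q. snd (f q)) \<and>
     immersion_on \<Omega> f"

section \<open>Slice conformal maps\<close>

text \<open>\<open>S\<close> is the transpose of the restriction of \<open>T\<close> to the subspace \<open>V\<close>; the library's
  \<^const>\<open>adjoint\<close> only covers maps defined on a whole type.\<close>

definition conformal_on ::
    "'a::euclidean_space set \<Rightarrow> ('a \<Rightarrow> 'b::euclidean_space) \<Rightarrow> bool" where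
  "conformal_on V T \<longleftrightarrow>
     subspace V \<and> linear T \<and>
     (\<exists>k S. k \<noteq> 0 \<and> linear S \<and> range S \<subseteq> V \<and>
        (\<forall>v\<in>V. \<forall>w. inner (T v) w = inner v (S w)) \<and>
        (\<forall>v\<in>V. S (T v) = k *\<^sub>R v))"

definition C1_on ::
    "'a::euclidean_space set \<Rightarrow> ('a \<Rightarrow> 'b::euclidean_space) \<Rightarrow> bool" where
  "C1_on \<Omega> f \<longleftrightarrow>
     (\<exists>f' :: 'a \<Rightarrow> 'a \<Rightarrow>\<^sub>L 'b. continuous_on \<Omega> f' \<and>
        (\<forall>q\<in>\<Omega>. (f has_derivative blinfun_apply (f' q)) (at q)))"

definition slice_conformal ::
    "'a::{euclidean_space, one, times} set \<Rightarrow> ('a \<Rightarrow> 'b::euclidean_space) \<Rightarrow> bool" where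
  "slice_conformal \<Omega> f \<longleftrightarrow>
     slice_domain \<Omega> \<and> DIM('a) \<le> DIM('b) \<and> C1_on \<Omega> f \<and>
     (\<forall>I\<in>imag_units. \<forall>x y. slice_point I x y \<in> \<Omega> \<longrightarrow>
        conformal_on (slice_plane I) (frechet_derivative f (at (slice_point I x y))) \<and>
        conformal_on ((slice_plane I)\<^sup>\<bottom>) (frechet_derivative f (at (slice_point I x y))))"

definition slice_conformal_parameterization ::
    "'a::{euclidean_space, one, times} set \<Rightarrow> ('a \<Rightarrow> 'b::euclidean_space) \<Rightarrow> bool" where
  "slice_conformal_parameterization \<Omega> f \<longleftrightarrow>
     slice_conformal \<Omega> f \<and> inj_on f \<Omega> \<and> immersion_on \<Omega> f"

text \<open>The argument of type \<^typ>\<open>'a itself\<close> records the algebra containing the parameter domain.\<close>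

definition parameterized_hypercomplex_Riemann_manifold ::
    "'a::{euclidean_space, one, times} itself \<Rightarrow> 'b::euclidean_space set \<Rightarrow> bool" where
  "parameterized_hypercomplex_Riemann_manifold _ M \<longleftrightarrow>
     (\<exists>(\<Omega> :: 'a set) f. slice_conformal_parameterization \<Omega> f \<and> M = f ` \<Omega>)"

end

(* On each slice, a slice regular g is holomorphic for the complex structure given by left
   multiplication with I. Around any point q of a slice domain, choose a connected open U in the
   complex plane that contains a real point and the coordinate of q and is mapped into the domain by
   all units I near that of q (by every unit if q is real). Two distinct units J, K determine alpha
   and beta on U with g(x + Jy) = alpha + J beta and g(x + Ky) = alpha + K beta. For every other
   admissible unit I both g(x + Iy) and alpha + I beta are holomorphic for the structure of I, and
   they agree on the real points since beta vanishes there; by the identity principle they agree on U.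
   Differentiating g = alpha + I beta shows that dg is right multiplication by the slice derivative c
   on C_I and right multiplication by the spherical derivative beta/|Im q| on the orthogonal
   complement of C_I. As the norm is multiplicative, right multiplications are conformal, and so are
   pairs of them. The formula also shows that g is C^1, which is not part of slice regularity. *)
theory Submission
  imports Defs "HOL-Complex_Analysis.Conformal_Mappings"
begin

section \<open>Conformality, differentiability and slice coordinates\<close>

text \<open>The transpose of \<open>T\<close> on \<open>V\<close> is built from an orthonormal basis
  \<open>B\<close> of \<open>V\<close>: its coordinate at \<open>b\<close> sends \<open>w\<close> to
  \<open>inner (T b) w\<close>. Once \<open>T\<close> scales inner products by \<open>k\<close>, the
  coordinates of \<open>S (T v)\<close> are \<open>k\<close> times those of
  \<open>v\<close>.\<close>

lemma conformal_onI:
  fixes T :: "'a::euclidean_space \<Rightarrow> 'b::euclidean_space"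
  assumes V: "subspace V" and T: "linear T" and k: "k \<noteq> 0"
    and inner_T: "\<And>v w. v \<in> V \<Longrightarrow> w \<in> V \<Longrightarrow> inner (T v) (T w) = k * inner v w"
  shows "conformal_on V T"
proof -
  obtain B where B: "B \<subseteq> V" "pairwise orthogonal B" "\<And>x. x \<in> B \<Longrightarrow> norm x = 1"
      "independent B" "span B = V"
    using orthonormal_basis_subspace[OF V] by metis
  have fin: "finite B"
    using B(4) independent_imp_finite by blast
  have expand: "(\<Sum>b\<in>B. inner v b *\<^sub>R b) = v" if "v \<in> V" for v
  proof (rule vector_eq_dot_span[of _ B])
    show "(\<Sum>b\<in>B. inner v b *\<^sub>R b) \<in> span B" "v \<in> span B"
      using that B(5) by (auto intro: span_sum span_scale span_base)
    fix c assume c: "c \<in> B"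
    have "inner c (\<Sum>b\<in>B. inner v b *\<^sub>R b) = (\<Sum>b\<in>B. if b = c then inner v c else 0)"
      unfolding inner_sum_right
      using B(2,3) c by (intro sum.cong) (auto simp: pairwise_def orthogonal_def dot_square_norm)
    then show "inner c (\<Sum>b\<in>B. inner v b *\<^sub>R b) = inner c v"
      using fin c by (simp add: inner_commute)
  qed
  define S where "S w = (\<Sum>b\<in>B. inner (T b) w *\<^sub>R b)" for w
  have "linear S"
    unfolding S_def
    by (intro linearI) (auto simp: inner_add_right scaleR_add_left sum.distrib scaleR_sum_right)
  moreover have "range S \<subseteq> V"
    using B(5) by (auto simp: S_def intro: span_sum span_scale span_base)
  moreover have "inner (T v) w = inner v (S w)" if "v \<in> V" for v w
  proof -
    have "inner (T v) w = inner (T (\<Sum>b\<in>B. inner v b *\<^sub>R b)) w"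
      by (simp add: expand that)
    also have "\<dots> = inner v (S w)"
      by (simp add: S_def linear_sum[OF T] linear_scale[OF T] inner_sum_left inner_sum_right
          mult.commute)
    finally show ?thesis .
  qed
  moreover have "S (T v) = k *\<^sub>R v" if "v \<in> V" for v
  proof -
    have "S (T v) = k *\<^sub>R (\<Sum>b\<in>B. inner v b *\<^sub>R b)"
      unfolding S_def scaleR_sum_right
      using that B(1) by (intro sum.cong) (auto simp: inner_T inner_commute)
    then show ?thesis
      by (simp add: expand that)
  qed
  ultimately show ?thesis
    using V T k unfolding conformal_on_def by blast
qed

definition im_part :: "'a::{real_inner, one} \<Rightarrow> 'a" where
  "im_part q = q - inner q 1 *\<^sub>R 1"

text \<open>The unit of a nonreal \<open>q\<close> is taken to be \<open>sgn (im_part q)\<close>, so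
  its imaginary coordinate is nonnegative. The coordinate stays continuous at real points, where the
  unit has no limit.\<close>

definition slice_coord :: "'a::{real_inner, one} \<Rightarrow> complex" where
  "slice_coord q = Complex (inner q 1) (norm (im_part q))"

lemma slice_coord_sel [simp]:
  "Re (slice_coord q) = inner q 1" "Im (slice_coord q) = norm (im_part q)"
  by (simp_all add: slice_coord_def)

lemma continuous_slice_coord: "continuous_on A slice_coord"
  unfolding slice_coord_def im_part_def complex_eq_iff Complex_eq by (intro continuous_intros)

lemma slice_point_sgn_im_part:
  "slice_point (sgn (im_part q)) (inner q 1) (norm (im_part q)) = q"
  by (cases "im_part q = 0") (simp_all add: slice_point_def sgn_div_norm im_part_def)

lemma isCont_eventually_nhds:
  assumes "isCont f x" "open S" "f x \<in> S"
  shows "\<forall>\<^sub>F y in nhds x. f y \<in> S"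
  by (metis assms continuous_at topological_tendstoD tendsto_at_iff_tendsto_nhds)

text \<open>For real \<open>q\<close> the factor \<open>sgn (im_part q)\<close> is \<open>0\<close>, and \<open>slice_proj q\<close> projects onto the real line.\<close>

definition slice_proj :: "'a::{real_inner, one} \<Rightarrow> 'a \<Rightarrow> 'a" where
  "slice_proj q h = inner h 1 *\<^sub>R 1 + inner h (sgn (im_part q)) *\<^sub>R sgn (im_part q)"

text \<open>In finite dimension continuity in operator norm can be tested on one vector
  \<open>h\<close> at a time, so continuity of the directional derivatives is enough.\<close>

lemma C1_onI:
  fixes f :: "'a::euclidean_space \<Rightarrow> 'b::euclidean_space"
  assumes D: "\<And>q. q \<in> \<Omega> \<Longrightarrow> f differentiable (at q)"
    and C: "\<And>q h. q \<in> \<Omega> \<Longrightarrow> isCont (\<lambda>p. frechet_derivative f (at p) h) q"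
    and \<Omega>: "open \<Omega>"
  shows "C1_on \<Omega> f"
proof -
  have apply_eq: "blinfun_apply (Blinfun (frechet_derivative f (at q))) = frechet_derivative f (at q)"
    if "q \<in> \<Omega>" for q
    using D[OF that] by (intro bounded_linear_Blinfun_apply)
      (metis frechet_derivative_works has_derivative_bounded_linear)
  have "continuous_on \<Omega> (\<lambda>q. Blinfun (frechet_derivative f (at q)))"
  proof (rule continuous_on_blinfun_componentwise)
    fix h :: 'a
    have "continuous_on \<Omega> (\<lambda>q. frechet_derivative f (at q) h)"
      using C by (auto intro: continuous_at_imp_continuous_on)
    then show "continuous_on \<Omega> (\<lambda>q. blinfun_apply (Blinfun (frechet_derivative f (at q))) h)"
      by (rule continuous_on_eq) (simp add: apply_eq)
  qed
  then show ?thesis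
    unfolding C1_on_def using D
    by (intro exI[of _ "\<lambda>q. Blinfun (frechet_derivative f (at q))"])
      (auto simp: apply_eq frechet_derivative_works)
qed

lemma frechet_derivative_Pair:
  assumes "(\<lambda>q. fst (f q)) differentiable (at x)" "(\<lambda>q. snd (f q)) differentiable (at x)"
  shows "f differentiable (at x)"
    and "frechet_derivative f (at x) h =
      (frechet_derivative (\<lambda>q. fst (f q)) (at x) h, frechet_derivative (\<lambda>q. snd (f q)) (at x) h)"
proof -
  have D: "(f has_derivative (\<lambda>h. (frechet_derivative (\<lambda>q. fst (f q)) (at x) h,
      frechet_derivative (\<lambda>q. snd (f q)) (at x) h))) (at x)"
    using has_derivative_Pair[of "\<lambda>q. fst (f q)" _ x UNIV "\<lambda>q. snd (f q)"] assms
    by (simp add: frechet_derivative_works)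
  then show "f differentiable (at x)"
    by (rule differentiableI)
  show "frechet_derivative f (at x) h =
      (frechet_derivative (\<lambda>q. fst (f q)) (at x) h, frechet_derivative (\<lambda>q. snd (f q)) (at x) h)"
    using fun_cong[OF frechet_derivative_at[OF D], of h] by simp
qed

section \<open>Euclidean composition algebras\<close>

text \<open>Quaternions and octonions share these properties; associativity is left out, so that one
  argument serves both. The dimension bound guarantees a direction orthogonal to \<open>1\<close>
  and to a given unit.\<close>

locale composition_algebra =
  fixes ty :: "'a::{euclidean_space, one, times} itself"
  assumes bilinear_mult: "bounded_bilinear ((*) :: 'a \<Rightarrow> 'a \<Rightarrow> 'a)"
    and norm_mult: "norm (x * y) = norm x * norm (y :: 'a)"
    and mult_1_left: "1 * x = (x :: 'a)"
    and mult_1_right: "x * 1 = (x :: 'a)"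
    and DIM_ge_3: "3 \<le> DIM('a)"
begin

sublocale mult: bounded_bilinear "(*) :: 'a \<Rightarrow> 'a \<Rightarrow> 'a"
  by (rule bilinear_mult)

lemma norm_one: "norm (1 :: 'a) = 1"
proof -
  obtain b :: 'a where "b \<in> Basis"
    using nonempty_Basis by blast
  then have "norm b = 1" "norm (1 * b) = norm b"
    by (auto simp: mult_1_left)
  then show ?thesis
    by (simp add: norm_mult)
qed

lemma inner_one_one: "inner (1 :: 'a) 1 = 1"
  by (simp add: dot_square_norm norm_one)

lemma inner_mult_self: "inner (x * y) (x * y) = inner x x * inner y (y :: 'a)"
  by (simp add: dot_square_norm norm_mult power_mult_distrib)

text \<open>Polarization of the multiplicative norm in the left factor. Polarizing in both factors
  gives the exchange law \<open>inner_mult_exchange\<close>.\<close>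

lemma inner_mult_right: "inner (x * z) (y * z) = inner x y * inner z (z :: 'a)"
  using inner_mult_self[of "x + y" z]
  by (simp add: mult.add_left inner_add_left inner_add_right inner_mult_self inner_commute
      algebra_simps)

lemma inner_mult_left: "inner (z * x) (z * y) = inner z z * inner x (y :: 'a)"
  using inner_mult_self[of z "x + y"]
  by (simp add: mult.add_right inner_add_left inner_add_right inner_mult_self inner_commute
      algebra_simps)

lemma inner_mult_exchange:
  "inner (u * x) (v * y) + inner (v * x) (u * y) = 2 * inner u v * inner x (y :: 'a)"
  using inner_mult_left[of "u + v" x y]
  by (simp add: mult.add_left inner_add_left inner_add_right inner_mult_left inner_commute
      algebra_simps)

text \<open>Taking \<open>1\<close> as one of the two multipliers in the exchange law makes its
  right-hand side vanish.\<close>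

lemma inner_mult_imag:
  assumes "inner u (1 :: 'a) = 0"
  shows "inner (u * x) y = - inner x (u * y)"
  using inner_mult_exchange[of u x 1 y] assms by (simp add: mult_1_left)

text \<open>Left multiplication by \<open>u\<close> is skew-adjoint and scales inner products by
  \<open>inner u u\<close>. The resulting identity stands in for associativity in the later
  computations.\<close>

lemma mult_imag_twice:
  assumes "inner u (1 :: 'a) = 0"
  shows "u * (u * x) = - (inner u u) *\<^sub>R x"
proof (rule vector_eq_rdot[THEN iffD1, rule_format])
  fix y :: 'a
  show "inner (u * (u * x)) y = inner (- (inner u u) *\<^sub>R x) y"
    using inner_mult_imag[OF assms, of "u * x" y] by (simp add: inner_mult_left)
qed

lemma imag_units_iff: "I \<in> imag_units \<longleftrightarrow> inner I 1 = 0 \<and> norm (I :: 'a) = 1"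
proof
  assume "inner I 1 = 0 \<and> norm I = 1"
  then show "I \<in> imag_units"
    using mult_imag_twice[of I 1] by (simp add: imag_units_def mult_1_right dot_square_norm)
next
  assume "I \<in> imag_units"
  then have sq: "I * I = - 1"
    by (simp add: imag_units_def)
  then have "norm I * norm I = 1"
    by (metis norm_minus_cancel norm_mult norm_one)
  then have n: "norm I = 1"
    using abs_square_eq_1[of "norm I"] by (simp add: power2_eq_square)
  \<comment> \<open>The real part of \<open>I * I\<close> is \<open>r * r - inner v v\<close> and
    the squared norm of \<open>I\<close> is \<open>r * r + inner v v\<close>; their values -1 and 1
    force \<open>r\<close> to vanish.\<close>
  define r v where "r = inner I 1" and "v = I - r *\<^sub>R 1"
  have v1: "inner v 1 = 0"
    by (simp add: v_def r_def inner_diff_left inner_one_one)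
  have I: "I = r *\<^sub>R 1 + v"
    by (simp add: v_def)
  have "inner (I * I) 1 = r * r - inner v v"
    using mult_imag_twice[OF v1, of 1] v1
    by (simp add: I mult.add_left mult.add_right mult.scaleR_left mult.scaleR_right mult_1_left
        mult_1_right inner_add_left inner_diff_left inner_one_one)
  moreover have "inner I I = r * r + inner v v"
    using v1 by (simp add: I inner_add_left inner_add_right inner_one_one inner_commute)
  moreover have "inner (I * I) 1 = - 1" "inner I I = 1"
    using sq n by (auto simp: norm_one dot_square_norm)
  ultimately have "r * r = 0"
    by linarith
  then show "inner I 1 = 0 \<and> norm I = 1"
    using n by (simp add: r_def)
qed

lemma imag_unit_mult_twice: "I \<in> imag_units \<Longrightarrow> I * (I * x) = - (x :: 'a)"
  using mult_imag_twice[of I x] by (simp add: imag_units_iff dot_square_norm)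

lemma ex_orthogonal_unit:
  obtains v :: 'a where "norm v = 1" "inner v 1 = 0" "inner v w = 0"
proof -
  have "dim {1, w} < DIM('a)"
    using dim_le_card[of "{1, w}" "{1, w}"] DIM_ge_3 card_insert_le_m1[of 2 "{w}" 1]
    by (auto simp: span_superset)
  then obtain x where "x \<noteq> 0" and x: "\<And>y. y \<in> span {1, w} \<Longrightarrow> orthogonal x y"
    using orthogonal_to_subspace_exists by blast
  have "inner x 1 = 0" "inner x w = 0"
    using x by (auto simp: orthogonal_def span_base)
  then show thesis
    using \<open>x \<noteq> 0\<close> that[of "x /\<^sub>R norm x"] by simp
qed

text \<open>Right multiplication by \<open>a\<close> scales inner products by the squared norm of
  \<open>a\<close>, so the pair scales them by the sum of two squared norms. Injectivity of
  \<open>T\<close>, applied to the nonzero \<open>v\<close>, excludes the factor zero.\<close>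

lemma conformal_on_right_mult:
  fixes T :: "'a \<Rightarrow> 'a \<times> 'a"
  assumes V: "subspace V" and T: "linear T" "inj T" and v: "v \<in> V" "v \<noteq> 0"
    and T_eq: "\<And>v. v \<in> V \<Longrightarrow> T v = (v * a, v * b)"
  shows "conformal_on V T"
proof (rule conformal_onI[OF V T(1)])
  have inner_T: "inner (T v) (T w) = (inner a a + inner b b) * inner v w" if "v \<in> V" "w \<in> V" for v w
    using that by (simp add: T_eq inner_mult_right algebra_simps)
  then show "inner (T v) (T w) = (inner a a + inner b b) * inner v w" if "v \<in> V" "w \<in> V" for v w
    using that by simp
  have "T v \<noteq> 0"
    using v T by (metis linear_injective_0)
  then show "inner a a + inner b b \<noteq> 0"
    using inner_T[OF v(1) v(1)] by auto
qed

section \<open>The local representation formula\<close>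

text \<open>The Cauchy-Riemann equation is built into the shape of the derivative: \<open>F'\<close>
  is the partial derivative in the real direction and \<open>I * F'\<close> the one in the imaginary
  direction.\<close>

definition left_holomorphic ::
    "'a \<Rightarrow> complex set \<Rightarrow> (complex \<Rightarrow> 'a) \<Rightarrow> (complex \<Rightarrow> 'a) \<Rightarrow> bool" where
  "left_holomorphic I U F F' \<longleftrightarrow> continuous_on U F' \<and>
     (\<forall>z\<in>U. (F has_derivative (\<lambda>h. Re h *\<^sub>R F' z + Im h *\<^sub>R (I * F' z))) (at z))"

lemma continuous_slice_point:
  "continuous_on U (\<lambda>z. slice_point (I::'a) (Re z) (Im z))"
  unfolding slice_point_def by (intro continuous_intros)

text \<open>Continuity of the partial derivatives upgrades them to a total derivative, and
  multiplying the Cauchy-Riemann equation by \<open>I\<close> expresses the second partial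
  derivative through the first.\<close>

lemma slice_regular_left_holomorphic:
  assumes g: "slice_regular_on \<Omega> (g :: 'a \<Rightarrow> 'a)" and I: "I \<in> imag_units" and U: "open U"
    and sub: "\<And>z. z \<in> U \<Longrightarrow> slice_point I (Re z) (Im z) \<in> \<Omega>"
  shows "\<exists>F'. left_holomorphic I U (\<lambda>z. g (slice_point I (Re z) (Im z))) F'"
proof -
  obtain gx gy where
      gx: "continuous_on (\<Omega> \<inter> slice_plane I) gx" and gy: "continuous_on (\<Omega> \<inter> slice_plane I) gy" and
      D: "\<And>x y. slice_point I x y \<in> \<Omega> \<Longrightarrow>
           ((\<lambda>t. g (slice_point I t y)) has_vector_derivative gx (slice_point I x y)) (at x) \<and>
           ((\<lambda>t. g (slice_point I x t)) has_vector_derivative gy (slice_point I x y)) (at y) \<and>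
           (1/2) *\<^sub>R (gx (slice_point I x y) + I * gy (slice_point I x y)) = 0"
    using g I unfolding slice_regular_on_def by meson
  have img: "(\<lambda>z. slice_point I (Re z) (Im z)) ` U \<subseteq> \<Omega> \<inter> slice_plane I"
    using sub by (auto simp: slice_plane_def)
  have gy_eq: "gy (slice_point I x y) = I * gx (slice_point I x y)" if "slice_point I x y \<in> \<Omega>" for x y
  proof -
    have "gx (slice_point I x y) = - (I * gy (slice_point I x y))"
      using D[OF that] by (simp add: add_eq_0_iff2)
    then show ?thesis
      using imag_unit_mult_twice[OF I] by (simp add: mult.minus_right)
  qed
  have "(g \<circ> (\<lambda>z. slice_point I (Re z) (Im z)) has_derivative
      (\<lambda>h. Re h *\<^sub>R gx (slice_point I (Re z) (Im z)) +
        Im h *\<^sub>R (I * gx (slice_point I (Re z) (Im z))))) (at z)" if z: "z \<in> U" for z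
  proof -
    obtain e where e: "e > 0" "ball z e \<subseteq> U"
      using U z open_contains_ball by blast
    \<comment> \<open>The passage from partial derivatives to a total one takes place on a product
      set; sides of half-length \<open>e/2\<close> keep the box inside the ball.\<close>
    define X Y where "X = ball (Re z) (e/2)" and "Y = ball (Im z) (e/2)"
    have XY: "Complex x y \<in> U" if "x \<in> X" "y \<in> Y" for x y
    proof -
      have "cmod (z - Complex x y) \<le> \<bar>Re z - x\<bar> + \<bar>Im z - y\<bar>"
        using cmod_le[of "z - Complex x y"] by simp
      also have "\<dots> < e"
        using that by (simp add: X_def Y_def dist_real_def)
      finally show ?thesis
        using e(2) by (auto simp: dist_norm)
    qed
    have z_in: "Re z \<in> X" "Im z \<in> Y"
      using e(1) by (auto simp: X_def Y_def)
    have "continuous_on (X \<times> Y) (\<lambda>p. gy (slice_point I (fst p) (snd p)))"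
      by (rule continuous_on_compose2[OF gy])
        (use sub[OF XY] in \<open>auto simp: slice_plane_def slice_point_def intro!: continuous_intros\<close>)
    then have "continuous_on (X \<times> Y) (\<lambda>(x, y). blinfun_scaleR_left (gy (slice_point I x y)))"
      by (auto simp: case_prod_unfold intro!: continuous_intros)
    then have cont: "continuous (at (Re z, Im z) within X \<times> Y)
        (\<lambda>(x, y). blinfun_scaleR_left (gy (slice_point I x y)))"
      using z_in by (auto simp: continuous_on_eq_continuous_within)
    have "((\<lambda>(x, y). g (slice_point I x y)) has_derivative
        (\<lambda>(s, t). s *\<^sub>R gx (slice_point I (Re z) (Im z)) +
           blinfun_apply (blinfun_scaleR_left (gy (slice_point I (Re z) (Im z)))) t))
        (at (Re z, Im z) within X \<times> Y)"
    proof (rule has_derivative_partialsI)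
      show "((\<lambda>x. g (slice_point I x (Im z))) has_derivative
          (\<lambda>s. s *\<^sub>R gx (slice_point I (Re z) (Im z)))) (at (Re z) within X)"
        using D[OF sub[OF z]] by (auto simp: has_vector_derivative_def intro: has_derivative_at_withinI)
      show "((\<lambda>y. g (slice_point I x y)) has_derivative
          blinfun_apply (blinfun_scaleR_left (gy (slice_point I x y)))) (at y within Y)"
        if "x \<in> X" "y \<in> Y" for x y
        using D[of x y] sub[OF XY[OF that]]
        by (auto simp: has_vector_derivative_def intro: has_derivative_at_withinI)
    qed (use z_in cont in \<open>auto simp: Y_def\<close>)
    moreover have "at (Re z, Im z) within X \<times> Y = at (Re z, Im z)"
      using z_in by (intro at_within_open open_Times) (auto simp: X_def Y_def)
    ultimately have "((\<lambda>(x, y). g (slice_point I x y)) has_derivative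
        (\<lambda>(s, t). s *\<^sub>R gx (slice_point I (Re z) (Im z)) +
           t *\<^sub>R (I * gx (slice_point I (Re z) (Im z)))))
        (at (Re z, Im z))"
      using sub[OF z] by (simp add: gy_eq)
    moreover have "((\<lambda>z. (Re z, Im z)) has_derivative (\<lambda>h. (Re h, Im h))) (at z)"
      by (auto intro!: derivative_eq_intros)
    ultimately show ?thesis
      using has_derivative_compose[of "\<lambda>z. (Re z, Im z)" "\<lambda>h. (Re h, Im h)" z UNIV
          "\<lambda>(x, y). g (slice_point I x y)"] by (fastforce simp: o_def)
  qed
  then show ?thesis
    unfolding left_holomorphic_def
    using continuous_on_compose2[OF gx continuous_slice_point img]
    by (auto simp: o_def)
qed

text \<open>Since \<open>U\<close> is open, its real points accumulate at \<open>r\<close>. The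
  scalar identity theorem then applies to the difference of the two functions, tested against every
  vector \<open>w\<close>.\<close>

lemma left_holomorphic_identity:
  assumes I: "I \<in> imag_units" and U: "open U" "connected U" "complex_of_real r \<in> U"
    and F: "left_holomorphic I U F F'" and G: "left_holomorphic I U G G'"
    and real_eq: "\<And>x. complex_of_real x \<in> U \<Longrightarrow> F (of_real x) = G (of_real x)"
    and z: "z \<in> U"
  shows "F z = G z"
proof (rule vector_eq_rdot[THEN iffD1, rule_format])
  fix w
  \<comment> \<open>\<open>\<phi>\<close> intertwines left multiplication by \<open>I\<close> with multiplication by \<open>\<i>\<close>, which reduces the claim
    to scalar holomorphic functions.\<close>
  define \<phi> where "\<phi> k = Complex (inner k w) (- inner (I * k) w)" for k
  have lin: "bounded_linear \<phi>"
    unfolding linear_conv_bounded_linear[symmetric]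
    by (intro linearI)
      (auto simp: \<phi>_def complex_eq_iff inner_add_left mult.add_right mult.scaleR_right)
  have \<phi>_mult: "\<phi> (I * k) = \<i> * \<phi> k" for k
    by (simp add: \<phi>_def imag_unit_mult_twice[OF I] complex_eq_iff)
  interpret \<phi>: bounded_linear \<phi> by (rule lin)
  have "((\<lambda>z. \<phi> (F z - G z)) has_field_derivative \<phi> (F' z - G' z)) (at z)" if "z \<in> U" for z
  proof -
    have "((\<lambda>z. F z - G z) has_derivative
        (\<lambda>h. (Re h *\<^sub>R F' z + Im h *\<^sub>R (I * F' z)) - (Re h *\<^sub>R G' z + Im h *\<^sub>R (I * G' z)))) (at z)"
      using F G that unfolding left_holomorphic_def by (intro has_derivative_diff) auto
    from bounded_linear.has_derivative[OF lin this] show ?thesis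
      unfolding has_field_derivative_def
      by (rule has_derivative_eq_rhs)
        (auto simp: fun_eq_iff \<phi>.add \<phi>.diff \<phi>.scaleR \<phi>_mult complex_eq_iff algebra_simps)
  qed
  then have hol: "(\<lambda>z. \<phi> (F z - G z)) holomorphic_on U"
    using U(1) by (auto simp: holomorphic_on_open)
  have "\<phi> (F z - G z) = 0"
  proof (rule analytic_continuation[OF hol U(1,2)])
    show "U \<inter> \<real> \<subseteq> U" "complex_of_real r \<in> U" "z \<in> U"
      using U z by auto
    show "complex_of_real r islimpt U \<inter> \<real>"
    proof (rule islimpt_approachable[THEN iffD2], intro allI impI)
      fix e :: real assume "e > 0"
      obtain d where d: "d > 0" "ball (complex_of_real r) d \<subseteq> U"
        using U open_contains_ball by blast
      show "\<exists>x'\<in>U \<inter> \<real>. x' \<noteq> complex_of_real r \<and> dist x' (complex_of_real r) < e"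
        using d \<open>e > 0\<close>
        by (intro bexI[of _ "complex_of_real (r + min d e / 2)"])
          (auto simp: dist_norm norm_of_real simp flip: of_real_diff of_real_add intro!: subsetD[OF d(2)])
    qed
    show "\<phi> (F z - G z) = 0" if "z \<in> U \<inter> \<real>" for z
      using that real_eq by (auto elim!: Reals_cases simp: \<phi>.zero)
  qed
  then show "inner (F z) w = inner (G z) w"
    by (simp add: \<phi>_def complex_eq_iff inner_diff_left)
qed

text \<open>The derivatives encode the Cauchy-Riemann equations; \<open>\<alpha>'\<close> and \<open>\<beta>'\<close> are the partial derivatives
  in the real direction.\<close>

definition stem_pair where
  "stem_pair U \<alpha> \<beta> \<alpha>' \<beta>' \<longleftrightarrow> open U \<and>
     continuous_on U \<alpha>' \<and> continuous_on U (\<beta>' :: complex \<Rightarrow> 'a) \<and>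
     (\<forall>x. complex_of_real x \<in> U \<longrightarrow> \<beta> (of_real x) = 0) \<and>
     (\<forall>z\<in>U. (\<alpha> has_derivative (\<lambda>h. Re h *\<^sub>R \<alpha>' z - Im h *\<^sub>R \<beta>' z)) (at z) \<and>
             (\<beta> has_derivative (\<lambda>h. Re h *\<^sub>R \<beta>' z + Im h *\<^sub>R \<alpha>' z)) (at z))"

text \<open>This is the representation formula near \<open>q0\<close>. At a real \<open>q\<close>
  the factor \<open>sgn (im_part q)\<close> is 0, which agrees with every choice of unit because
  \<open>\<beta>\<close> vanishes on the real axis.\<close>

definition has_local_stem :: "('a \<Rightarrow> 'a) \<Rightarrow> 'a \<Rightarrow> bool" where
  "has_local_stem g q0 \<longleftrightarrow> (\<exists>U \<alpha> \<beta> \<alpha>' \<beta>'. stem_pair U \<alpha> \<beta> \<alpha>' \<beta>' \<and> slice_coord q0 \<in> U \<and>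
     (\<forall>\<^sub>F q in nhds q0. g q = \<alpha> (slice_coord q) + sgn (im_part q) * \<beta> (slice_coord q)))"

lemma inner_im_part_1 [simp]: "inner (im_part (q :: 'a)) 1 = 0"
  by (simp add: im_part_def inner_diff_left inner_one_one)

lemma sgn_im_part_imag_units: "im_part (q :: 'a) \<noteq> 0 \<Longrightarrow> sgn (im_part q) \<in> imag_units"
  by (simp add: imag_units_iff norm_sgn sgn_div_norm)

text \<open>The two equations for \<open>J\<close> and \<open>K\<close> form a linear system for
  \<alpha> and \<beta>: subtracting them leaves \<open>J - K\<close> times \<beta>, and
  \<open>J - K\<close> is invertible. The remaining units are reached by the identity principle from
  the real axis.\<close>

lemma stem_pair_exists:
  assumes g: "slice_regular_on \<Omega> (g :: 'a \<Rightarrow> 'a)"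
    and U: "open U" "connected U" "complex_of_real r \<in> U"
    and N: "N \<subseteq> imag_units" "J \<in> N" "K \<in> N" "J \<noteq> K"
    and sub: "\<And>I z. I \<in> N \<Longrightarrow> z \<in> U \<Longrightarrow> slice_point I (Re z) (Im z) \<in> \<Omega>"
  shows "\<exists>\<alpha> \<beta> \<alpha>' \<beta>'. stem_pair U \<alpha> \<beta> \<alpha>' \<beta>' \<and>
    (\<forall>I\<in>N. \<forall>z\<in>U. g (slice_point I (Re z) (Im z)) = \<alpha> z + I * \<beta> z)"
proof -
  define F where "F I z = g (slice_point I (Re z) (Im z))" for I z
  have "\<exists>F'. left_holomorphic I U (F I) F'" if "I \<in> N" for I
    unfolding F_def using slice_regular_left_holomorphic[OF g _ U(1)] that N(1) sub by blast
  then obtain F' where F': "\<And>I. I \<in> N \<Longrightarrow> left_holomorphic I U (F I) (F' I)"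
    by metis
  have JK: "J \<in> imag_units" "K \<in> imag_units"
    using N by auto
  define u where "u = J - K"
  have u: "inner u 1 = 0" "inner u u \<noteq> 0"
    using JK by (simp add: u_def imag_units_iff inner_diff_left) (simp add: u_def N(4))
  \<comment> \<open>Left multiplication by \<open>J - K\<close> is inverted without associativity: \<open>u * (u * x)\<close> is a multiple of \<open>x\<close>.\<close>
  define M where "M x = - (1 / inner u u) *\<^sub>R (u * x)" for x
  have uM: "u * M x = x" and Mu: "M (u * x) = x" for x
    using u(2) by (simp_all add: M_def mult.scaleR_right mult.minus_right mult_imag_twice[OF u(1)])
  have M: "bounded_linear M"
    unfolding M_def
    by (intro bounded_linear_scaleR_right bounded_linear_compose[OF bounded_linear_scaleR_right]
        mult.bounded_linear_right)
  interpret M: bounded_linear M by (rule M)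
  define \<beta> \<alpha> \<beta>' \<alpha>' where "\<beta> z = M (F J z - F K z)" and "\<alpha> z = F J z - J * \<beta> z"
    and "\<beta>' z = M (F' J z - F' K z)" and "\<alpha>' z = F' J z - J * \<beta>' z" for z
  \<comment> \<open>The definition of \<open>\<alpha>'\<close> is symmetric in the two units; both
    forms are needed to let \<open>\<beta>'\<close> cancel in the next computation.\<close>
  have \<alpha>'_K: "\<alpha>' z = F' K z - K * \<beta>' z" for z
  proof -
    have "J * \<beta>' z - K * \<beta>' z = F' J z - F' K z"
      by (simp add: \<beta>'_def uM flip: mult.diff_left u_def)
    then have "F' J z = F' K z + (J * \<beta>' z - K * \<beta>' z)"
      by simp
    then show ?thesis
      by (simp add: \<alpha>'_def)
  qed
  \<comment> \<open>This identifies the derivative of \<beta> in the imaginary direction with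
    \<open>\<alpha>'\<close>, which is one of the Cauchy-Riemann equations of the pair.\<close>
  have "u * \<alpha>' z = J * F' J z - K * F' K z" for z
  proof -
    have "u * \<alpha>' z = J * \<alpha>' z - K * \<alpha>' z"
      by (simp add: u_def mult.diff_left)
    also have "J * \<alpha>' z = J * F' J z + \<beta>' z"
      by (simp add: \<alpha>'_def mult.diff_right imag_unit_mult_twice[OF JK(1)])
    also have "K * \<alpha>' z = K * F' K z + \<beta>' z"
      by (simp add: \<alpha>'_K mult.diff_right imag_unit_mult_twice[OF JK(2)])
    finally show ?thesis
      by simp
  qed
  then have M_y: "M (J * F' J z - K * F' K z) = \<alpha>' z" for z
    by (metis Mu)
  have D: "(F I has_derivative (\<lambda>h. Re h *\<^sub>R F' I z + Im h *\<^sub>R (I * F' I z))) (at z)"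
    if "I \<in> N" "z \<in> U" for I z
    using F'[OF that(1)] that(2) by (auto simp: left_holomorphic_def)
  have D\<beta>: "(\<beta> has_derivative (\<lambda>h. Re h *\<^sub>R \<beta>' z + Im h *\<^sub>R \<alpha>' z)) (at z)" if "z \<in> U" for z
  proof -
    have "((\<lambda>z. M (F J z - F K z)) has_derivative (\<lambda>h. M ((Re h *\<^sub>R F' J z + Im h *\<^sub>R (J * F' J z))
        - (Re h *\<^sub>R F' K z + Im h *\<^sub>R (K * F' K z))))) (at z)"
      by (intro bounded_linear.has_derivative[OF M] has_derivative_diff D that N)
    then show ?thesis
      unfolding \<beta>_def[symmetric]
      by (rule has_derivative_eq_rhs)
        (simp add: fun_eq_iff \<beta>'_def M_y[symmetric] M.add M.diff M.scaleR scaleR_diff_right)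
  qed
  have D\<alpha>: "(\<alpha> has_derivative (\<lambda>h. Re h *\<^sub>R \<alpha>' z - Im h *\<^sub>R \<beta>' z)) (at z)" if "z \<in> U" for z
  proof -
    have eq: "J * F' J z - J * \<alpha>' z = - \<beta>' z"
      by (simp add: \<alpha>'_def mult.diff_right imag_unit_mult_twice[OF JK(1)])
    have "((\<lambda>z. F J z - J * \<beta> z) has_derivative (\<lambda>h. (Re h *\<^sub>R F' J z + Im h *\<^sub>R (J * F' J z))
        - J * (Re h *\<^sub>R \<beta>' z + Im h *\<^sub>R \<alpha>' z))) (at z)"
      by (intro has_derivative_diff D bounded_linear.has_derivative[OF mult.bounded_linear_right]
          D\<beta> that N)
    then show ?thesis
      unfolding \<alpha>_def[symmetric]
    proof (rule has_derivative_eq_rhs, intro ext)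
      fix h
      have "Re h *\<^sub>R F' J z + Im h *\<^sub>R (J * F' J z) - J * (Re h *\<^sub>R \<beta>' z + Im h *\<^sub>R \<alpha>' z) =
          Re h *\<^sub>R (F' J z - J * \<beta>' z) + Im h *\<^sub>R (J * F' J z - J * \<alpha>' z)"
        by (simp add: mult.add_right mult.scaleR_right algebra_simps)
      then show "Re h *\<^sub>R F' J z + Im h *\<^sub>R (J * F' J z) - J * (Re h *\<^sub>R \<beta>' z + Im h *\<^sub>R \<alpha>' z) =
          Re h *\<^sub>R \<alpha>' z - Im h *\<^sub>R \<beta>' z"
        by (simp add: eq) (simp add: \<alpha>'_def)
    qed
  qed
  have cF': "continuous_on U (F' I)" if "I \<in> N" for I
    using F'[OF that] by (auto simp: left_holomorphic_def)
  have c\<beta>': "continuous_on U \<beta>'"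
    unfolding \<beta>'_def by (intro M.continuous_on continuous_on_diff cF' N)
  have c\<alpha>': "continuous_on U \<alpha>'"
    unfolding \<alpha>'_def
    by (intro bounded_linear.continuous_on[OF mult.bounded_linear_right] continuous_on_diff
        cF' N c\<beta>')
  \<comment> \<open>All slices meet in the real axis, so \<open>F J\<close> and \<open>F K\<close>
    have the same value there.\<close>
  have real0: "\<beta> (of_real x) = 0" for x
    by (simp add: \<beta>_def F_def slice_point_def M.zero)
  have "stem_pair U \<alpha> \<beta> \<alpha>' \<beta>'"
    using U(1) D\<alpha> D\<beta> c\<alpha>' c\<beta>' real0 by (simp add: stem_pair_def)
  moreover have "F I z = \<alpha> z + I * \<beta> z" if I: "I \<in> N" and z: "z \<in> U" for I z
  proof (rule left_holomorphic_identity[OF _ U F'[OF I] _ _ z])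
    show I': "I \<in> imag_units"
      using N(1) I by auto
    show "left_holomorphic I U (\<lambda>z. \<alpha> z + I * \<beta> z) (\<lambda>z. \<alpha>' z + I * \<beta>' z)"
      unfolding left_holomorphic_def
    proof (intro conjI ballI)
      show "continuous_on U (\<lambda>z. \<alpha>' z + I * \<beta>' z)"
        by (intro continuous_on_add c\<alpha>' c\<beta>' bounded_linear.continuous_on[OF mult.bounded_linear_right])
      fix z assume "z \<in> U"
      then have "((\<lambda>z. \<alpha> z + I * \<beta> z) has_derivative (\<lambda>h. Re h *\<^sub>R \<alpha>' z - Im h *\<^sub>R \<beta>' z +
          I * (Re h *\<^sub>R \<beta>' z + Im h *\<^sub>R \<alpha>' z))) (at z)"
        by (intro has_derivative_add D\<alpha> D\<beta> bounded_linear.has_derivative[OF mult.bounded_linear_right])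
      then show "((\<lambda>z. \<alpha> z + I * \<beta> z) has_derivative (\<lambda>h. Re h *\<^sub>R (\<alpha>' z + I * \<beta>' z) +
          Im h *\<^sub>R (I * (\<alpha>' z + I * \<beta>' z)))) (at z)"
        by (rule has_derivative_eq_rhs)
          (simp add: fun_eq_iff mult.add_right mult.scaleR_right imag_unit_mult_twice[OF I']
            algebra_simps)
    qed
    show "F I (of_real x) = \<alpha> (of_real x) + I * \<beta> (of_real x)" for x
      by (simp add: real0 \<alpha>_def mult.zero_right) (simp add: F_def slice_point_def)
  qed
  ultimately show ?thesis
    unfolding F_def by blast
qed

section \<open>Local stems at real and at nonreal points\<close>

lemma norm_slice_point:
  assumes "(I :: 'a) \<in> imag_units"
  shows "norm (slice_point I x y) = cmod (Complex x y)"
proof -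
  have "inner I 1 = 0" "inner 1 I = 0" "inner I I = 1"
    using assms by (auto simp: imag_units_iff dot_square_norm inner_commute)
  then have "inner (slice_point I x y) (slice_point I x y) = x\<^sup>2 + y\<^sup>2"
    by (simp add: slice_point_def inner_add_left inner_add_right inner_one_one power2_eq_square)
  then show ?thesis
    by (simp add: norm_eq_sqrt_inner[of "slice_point I x y"] cmod_def)
qed

lemma ex_imag_unit: "\<exists>J :: 'a. J \<in> imag_units"
  using ex_orthogonal_unit[of 1] by (metis imag_units_iff)

text \<open>Rotating \<open>I\<close> slightly towards a unit vector orthogonal to \<open>1\<close>
  and \<open>I\<close> stays in the sphere of imaginary units. This supplies the second unit for the
  representation near a nonreal point.\<close>

lemma imag_units_accumulate:
  assumes I: "(I :: 'a) \<in> imag_units" and "e > 0"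
  shows "\<exists>K\<in>imag_units. K \<noteq> I \<and> dist I K < e"
proof -
  obtain v :: 'a where v: "norm v = 1" "inner v 1 = 0" "inner v I = 0"
    using ex_orthogonal_unit by blast
  define K where "K t = cos t *\<^sub>R I + sin t *\<^sub>R v" for t
  have "isCont K 0"
    unfolding K_def by (intro continuous_intros)
  then obtain d where d: "d > 0" "\<And>t. \<bar>t\<bar> < d \<Longrightarrow> dist (K t) I < e"
    using \<open>e > 0\<close> unfolding continuous_at_eps_delta by (auto simp: K_def dist_real_def)
  \<comment> \<open>The bound 1 keeps \<open>t\<close> below pi, so \<open>sin t\<close> is positive
    and \<open>K t\<close> differs from \<open>I\<close>.\<close>
  define t where "t = min (d/2) 1"
  have t: "0 < t" "t < pi" "t < d"
    using d(1) pi_gt3 by (auto simp: t_def)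
  have "inner v v = 1" "inner I I = 1" "inner I v = 0"
    using v I by (auto simp: imag_units_iff dot_square_norm inner_commute)
  then have "inner (K t) (K t) = 1"
    using v(3) by (simp add: K_def inner_add_left inner_add_right sin_cos_squared_add3)
  then have "K t \<in> imag_units"
    using v I by (simp add: imag_units_iff norm_eq_1) (simp add: K_def inner_add_left)
  moreover have "inner v (K t) = sin t"
    using v by (simp add: K_def inner_add_right dot_square_norm)
  then have "K t \<noteq> I"
    using sin_gt_zero[OF t(1,2)] v by auto
  ultimately show ?thesis
    using d(2)[of t] t by (auto simp: dist_commute)
qed

lemma im_part_slice_point:
  assumes "(I :: 'a) \<in> imag_units"
  shows "im_part (slice_point I x y) = y *\<^sub>R I" "inner (slice_point I x y) 1 = x"
  using assms by (simp_all add: im_part_def slice_point_def imag_units_iff inner_add_left inner_one_one)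

text \<open>Distances from a real centre are the same in every slice, so one disc of coordinates
  works for all units at once, and \<open>J\<close> and \<open>- J\<close> can serve as the two
  distinct units.\<close>

lemma has_local_stem_real:
  assumes \<Omega>: "open \<Omega>" and g: "slice_regular_on \<Omega> (g :: 'a \<Rightarrow> 'a)" and q0: "x0 *\<^sub>R 1 \<in> \<Omega>"
  shows "has_local_stem g (x0 *\<^sub>R 1)"
proof -
  obtain e where e: "e > 0" "ball (x0 *\<^sub>R 1) e \<subseteq> \<Omega>"
    using \<Omega> q0 open_contains_ball by blast
  obtain J :: 'a where J: "J \<in> imag_units"
    using ex_imag_unit by blast
  then have mJ: "- J \<in> imag_units" "J \<noteq> - J"
    by (auto simp: imag_units_iff eq_neg_iff_add_eq_0 simp flip: scaleR_2)
  have dist_eq: "dist (x0 *\<^sub>R 1) (slice_point I (Re z) (Im z)) = dist (of_real x0) z"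
    if "(I :: 'a) \<in> imag_units" for I z
  proof -
    have "slice_point I (Re z) (Im z) - x0 *\<^sub>R 1 = slice_point I (Re z - x0) (Im z)"
      by (simp add: slice_point_def algebra_simps)
    moreover have "Complex (Re z - x0) (Im z) = z - of_real x0"
      by (simp add: complex_eq_iff)
    ultimately show ?thesis
      using norm_slice_point[OF that] by (metis dist_commute dist_norm)
  qed
  obtain \<alpha> \<beta> \<alpha>' \<beta>' where stem: "stem_pair (ball (complex_of_real x0) e) \<alpha> \<beta> \<alpha>' \<beta>'"
    and rep: "\<And>I z. I \<in> imag_units \<Longrightarrow> z \<in> ball (of_real x0) e \<Longrightarrow>
      g (slice_point I (Re z) (Im z)) = \<alpha> z + I * \<beta> z"
    using stem_pair_exists[OF g, of "ball (of_real x0) e" x0 imag_units J "- J"] e J mJ dist_eq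
    by (auto simp: subset_iff)
  have "g q = \<alpha> (slice_coord q) + sgn (im_part q) * \<beta> (slice_coord q)"
    if q: "q \<in> ball (x0 *\<^sub>R 1) e" for q
  proof (cases "im_part q = 0")
    case False
    then have I: "sgn (im_part q) \<in> imag_units"
      by (rule sgn_im_part_imag_units)
    moreover have "slice_coord q \<in> ball (of_real x0) e"
      using q dist_eq[OF I, of "slice_coord q"] by (simp add: slice_point_sgn_im_part)
    ultimately show ?thesis
      using rep[of "sgn (im_part q)" "slice_coord q"] by (simp add: slice_point_sgn_im_part)
  next
    \<comment> \<open>A real \<open>q\<close> lies in every slice, in particular in that of
      \<open>J\<close>. Since \<beta> vanishes at its coordinate, replacing \<open>J\<close> by the
      default value 0 of \<open>sgn\<close> changes nothing.\<close>
    case True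
    then have z: "slice_coord q = of_real (inner q 1)" and q_eq: "q = slice_point J (inner q 1) 0"
      by (auto simp: complex_eq_iff slice_point_def im_part_def)
    have "slice_coord q \<in> ball (of_real x0) e"
      using q dist_eq[OF J, of "slice_coord q"] q_eq True by simp
    then have "g q = \<alpha> (slice_coord q) + J * \<beta> (slice_coord q)" "\<beta> (slice_coord q) = 0"
      using rep[OF J, of "slice_coord q"] stem q_eq True z by (auto simp: stem_pair_def)
    then show ?thesis
      by (simp add: mult.zero_right)
  qed
  then have "\<forall>\<^sub>F q in nhds (x0 *\<^sub>R 1). g q = \<alpha> (slice_coord q) + sgn (im_part q) * \<beta> (slice_coord q)"
    using e(1) by (intro eventually_nhds_in_open[of "ball (x0 *\<^sub>R 1) e", THEN eventually_mono]) auto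
  moreover have "slice_coord (x0 *\<^sub>R 1 :: 'a) = of_real x0"
    by (simp add: complex_eq_iff im_part_def inner_one_one)
  ultimately show ?thesis
    using stem e(1) unfolding has_local_stem_def by (metis centre_in_ball)
qed

text \<open>The identity principle needs coordinates that reach the real axis and remain admissible
  for all units near \<open>I0\<close>. A path from \<open>z0\<close> to a real point inside the
  slice is compact, so by a tube argument a uniform neighbourhood of it stays in the domain when the
  unit is perturbed.\<close>

lemma slice_domain_tube:
  assumes \<Omega>: "slice_domain \<Omega>" and I0: "(I0 :: 'a) \<in> imag_units"
    and z0: "slice_point I0 (Re z0) (Im z0) \<in> \<Omega>"
  obtains U e r where "open U" "connected U" "z0 \<in> U" "complex_of_real r \<in> U" "e > 0"
    "\<And>I z. dist I0 I < e \<Longrightarrow> z \<in> U \<Longrightarrow> slice_point I (Re z) (Im z) \<in> \<Omega>"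
proof -
  obtain r where r: "r *\<^sub>R 1 \<in> \<Omega>"
    using \<Omega> unfolding slice_domain_def by blast
  have open_\<Omega>: "open \<Omega>" and conn: "connected (\<Omega> \<inter> slice_plane I0)"
    using \<Omega> I0 by (auto simp: slice_domain_def)
  have I0': "inner I0 1 = 0" "inner 1 I0 = 0" "inner I0 I0 = 1"
    using I0 by (auto simp: imag_units_iff dot_square_norm inner_commute)
  define W where "W = (\<lambda>z. slice_point I0 (Re z) (Im z)) -` \<Omega>"
  have "open W"
    unfolding W_def by (intro open_vimage open_\<Omega> continuous_slice_point)
  \<comment> \<open>Taking inner products with \<open>1\<close> and \<open>I0\<close> inverts the
    slice parametrization, which carries connectedness of the slice over to
    \<open>W\<close>.\<close>
  moreover have "W = (\<lambda>q. Complex (inner q 1) (inner q I0)) ` (\<Omega> \<inter> slice_plane I0)"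
  proof (intro equalityI subsetI)
    fix z assume "z \<in> W"
    then show "z \<in> (\<lambda>q. Complex (inner q 1) (inner q I0)) ` (\<Omega> \<inter> slice_plane I0)"
      using I0' by (intro image_eqI[of _ _ "slice_point I0 (Re z) (Im z)"])
        (auto simp: W_def slice_plane_def slice_point_def inner_add_left inner_one_one)
  qed (use I0' in \<open>auto simp: W_def slice_plane_def slice_point_def inner_add_left inner_one_one\<close>)
  then have "connected W"
    using conn by (auto simp: Complex_eq intro!: connected_continuous_image continuous_intros)
  ultimately have "path_connected W"
    by (rule connected_open_path_connected)
  moreover have "complex_of_real r \<in> W" "z0 \<in> W"
    using r z0 by (auto simp: W_def slice_point_def)
  ultimately obtain p where p: "path p" "path_image p \<subseteq> W" "pathstart p = of_real r" "pathfinish p = z0"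
    unfolding path_connected_def by blast
  define P where "P = path_image p"
  have P: "compact P" "connected P" "P \<subseteq> W" "of_real r \<in> P" "z0 \<in> P"
    using p pathstart_in_path_image[of p] pathfinish_in_path_image[of p]
    by (auto simp: P_def compact_path_image connected_path_image)
  define Z where "Z = (\<lambda>x. slice_point (fst x) (Re (snd x)) (Im (snd x))) -` \<Omega>"
  have "open Z"
    unfolding Z_def slice_point_def by (intro open_vimage open_\<Omega> continuous_intros)
  moreover have "compact ({I0} \<times> P)" "{I0} \<times> P \<subseteq> Z"
    using P by (auto simp: compact_Times Z_def W_def)
  ultimately obtain e where e: "e > 0" "(\<Union>x\<in>{I0} \<times> P. ball x e) \<subseteq> Z"
    using compact_subset_open_imp_ball_epsilon_subset by metis
  \<comment> \<open>Half of \<open>e\<close> is left for the perturbation of the unit. Writing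
    \<open>U\<close> as the sum of the path and a ball shows that it is connected.\<close>
  define U where "U = (\<Union>z\<in>P. ball z (e/2))"
  have U_eq: "U = (\<lambda>x. fst x + snd x) ` (P \<times> ball 0 (e/2))"
  proof (intro equalityI subsetI)
    fix z assume "z \<in> U"
    then obtain w where "w \<in> P" "dist w z < e/2"
      by (auto simp: U_def)
    then show "z \<in> (\<lambda>x. fst x + snd x) ` (P \<times> ball 0 (e/2))"
      by (intro image_eqI[of _ _ "(w, z - w)"]) (auto simp: dist_norm norm_minus_commute)
  qed (auto simp: U_def dist_norm intro!: bexI)
  have PU: "P \<subseteq> U"
    using e(1) by (force simp: U_def)
  show thesis
  proof (rule that)
    show "open U"
      by (auto simp: U_def)
    show "connected U"
      unfolding U_eq
      by (intro connected_continuous_image continuous_intros connected_Times P) auto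
    show "z0 \<in> U" "of_real r \<in> U" "e / 2 > 0"
      using P(4,5) PU e(1) by auto
    show "slice_point I (Re z) (Im z) \<in> \<Omega>" if I: "dist I0 I < e/2" and z: "z \<in> U" for I z
    proof -
      obtain w where w: "w \<in> P" "dist w z < e/2"
        using z by (auto simp: U_def)
      have "dist (I0, w) (I, z) \<le> dist I0 I + dist w z"
        unfolding dist_Pair_Pair by (intro sqrt_sum_squares_le_sum) auto
      then have "(I, z) \<in> ball (I0, w) e"
        using w I by simp
      then have "(I, z) \<in> Z"
        using e(2) w(1) by blast
      then show ?thesis
        by (simp add: Z_def)
    qed
  qed
qed

text \<open>Real points are covered by a full disc. A nonreal point uses only the units near its
  own, with the tube providing the coordinates and a nearby unit \<open>K\<close> as the second
  one.\<close>

lemma slice_domain_has_local_stem: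
  assumes \<Omega>: "slice_domain \<Omega>" and g: "slice_regular_on \<Omega> (g :: 'a \<Rightarrow> 'a)" and q0: "q0 \<in> \<Omega>"
  shows "has_local_stem g q0"
proof (cases "im_part q0 = 0")
  case True
  then have "q0 = inner q0 1 *\<^sub>R 1"
    by (simp add: im_part_def)
  then show ?thesis
    using has_local_stem_real[OF _ g] \<Omega> q0 by (metis slice_domain_def)
next
  case False
  define I0 where "I0 = sgn (im_part q0)"
  have I0: "I0 \<in> imag_units"
    using False by (simp add: I0_def sgn_im_part_imag_units)
  have q0': "slice_point I0 (Re (slice_coord q0)) (Im (slice_coord q0)) \<in> \<Omega>"
    using q0 by (simp add: I0_def slice_point_sgn_im_part)
  obtain U e r where
      U: "open U" "connected U" "slice_coord q0 \<in> U" "complex_of_real r \<in> U" and e: "e > 0" and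
      sub: "\<And>I z. dist I0 I < e \<Longrightarrow> z \<in> U \<Longrightarrow> slice_point I (Re z) (Im z) \<in> \<Omega>"
    by (rule slice_domain_tube[OF \<Omega> I0 q0']) (rule that)
  obtain K where K: "K \<in> imag_units" "K \<noteq> I0" "dist I0 K < e"
    using imag_units_accumulate[OF I0 e] by blast
  have "\<exists>\<alpha> \<beta> \<alpha>' \<beta>'. stem_pair U \<alpha> \<beta> \<alpha>' \<beta>' \<and>
      (\<forall>I\<in>imag_units \<inter> ball I0 e. \<forall>z\<in>U. g (slice_point I (Re z) (Im z)) = \<alpha> z + I * \<beta> z)"
  proof (rule stem_pair_exists[OF g U(1,2,4) _ _ _ K(2)])
    show "K \<in> imag_units \<inter> ball I0 e" "I0 \<in> imag_units \<inter> ball I0 e"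
      using K(1,3) I0 e by auto
    show "slice_point I (Re z) (Im z) \<in> \<Omega>" if "I \<in> imag_units \<inter> ball I0 e" "z \<in> U" for I z
      using that by (intro sub) auto
  qed auto
  then obtain \<alpha> \<beta> \<alpha>' \<beta>' where stem: "stem_pair U \<alpha> \<beta> \<alpha>' \<beta>'"
    and rep: "\<And>I z. I \<in> imag_units \<inter> ball I0 e \<Longrightarrow> z \<in> U \<Longrightarrow>
      g (slice_point I (Re z) (Im z)) = \<alpha> z + I * \<beta> z"
    by blast
  \<comment> \<open>Off the real axis the unit depends continuously on the point, so all points near
    \<open>q0\<close> have an admissible unit and a coordinate in \<open>U\<close>.\<close>
  have "isCont im_part q0"
    unfolding im_part_def by (intro continuous_intros)
  then have "isCont (\<lambda>q. sgn (im_part q)) q0"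
    using False by (auto intro!: continuous_intros)
  then have "\<forall>\<^sub>F q in nhds q0. sgn (im_part q) \<in> ball I0 e"
    using e by (intro isCont_eventually_nhds) (auto simp: I0_def)
  moreover have "\<forall>\<^sub>F q in nhds q0. im_part q \<in> - {0}"
    using \<open>isCont im_part q0\<close> False by (intro isCont_eventually_nhds) auto
  moreover have "\<forall>\<^sub>F q in nhds q0. slice_coord q \<in> U"
    using continuous_slice_coord[of UNIV] U(1,3)
    by (intro isCont_eventually_nhds) (auto simp: continuous_on_eq_continuous_at)
  ultimately have "\<forall>\<^sub>F q in nhds q0. g q = \<alpha> (slice_coord q) + sgn (im_part q) * \<beta> (slice_coord q)"
  proof eventually_elim
    case (elim q)
    then show ?case
      using rep[of "sgn (im_part q)" "slice_coord q"] sgn_im_part_imag_units[of q]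
      by (simp add: slice_point_sgn_im_part)
  qed
  then show ?thesis
    using stem U(3) unfolding has_local_stem_def by blast
qed

section \<open>The differential of a slice regular function\<close>

text \<open>For a real \<open>q\<close> the unit is 0 and only \<open>\<alpha>'\<close> is left; for
  a stem pair this loses nothing, because \<open>\<beta>'\<close> vanishes at real points.\<close>

definition stem_slice_deriv where
  "stem_slice_deriv \<alpha>' \<beta>' q = \<alpha>' (slice_coord q) + sgn (im_part q) * (\<beta>' (slice_coord q) :: 'a)"

text \<open>At a real point \<open>\<alpha>'\<close> equals the derivative of \<open>\<beta>\<close> in the imaginary direction, the limit of
  the quotient.\<close>

definition stem_spherical_deriv where
  "stem_spherical_deriv \<alpha>' \<beta> q = (if im_part q = 0 then \<alpha>' (slice_coord q)
     else \<beta> (slice_coord q) /\<^sub>R norm (im_part (q :: 'a)))"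

lemma has_derivative_norm_im_part:
  assumes "im_part (q :: 'a) \<noteq> 0"
  shows "((\<lambda>p. norm (im_part p)) has_derivative (\<lambda>h. inner h (sgn (im_part q)))) (at q)"
proof -
  have "(im_part has_derivative im_part) (at q)"
    unfolding im_part_def by (auto intro!: derivative_eq_intros)
  moreover have "(norm has_derivative (\<lambda>h. inner h (sgn (im_part q)))) (at (im_part q))"
    by (rule has_derivative_norm[OF assms])
  ultimately have "((\<lambda>p. norm (im_part p)) has_derivative (\<lambda>h. inner (im_part h) (sgn (im_part q)))) (at q)"
    by (rule has_derivative_compose)
  moreover have "inner (im_part h) (sgn (im_part q)) = inner h (sgn (im_part q))" for h :: 'a
  proof -
    have "inner 1 (sgn (im_part q)) = 0"
      by (metis inner_commute inner_im_part_1 inner_scaleR_right mult_zero_right sgn_div_norm)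
    then show ?thesis
      by (simp add: im_part_def[of h] inner_diff_left)
  qed
  ultimately show ?thesis
    by simp
qed

lemma has_derivative_slice_coord:
  assumes "im_part (q :: 'a) \<noteq> 0"
  shows "(slice_coord has_derivative (\<lambda>h. Complex (inner h 1) (inner h (sgn (im_part q))))) (at q)"
proof -
  have "((\<lambda>p. of_real (inner p 1) + \<i> * of_real (norm (im_part p))) has_derivative
      (\<lambda>h. of_real (inner h 1) + \<i> * of_real (inner h (sgn (im_part q))))) (at q)"
    by (intro has_derivative_add has_derivative_of_real has_derivative_mult_right
        has_derivative_norm_im_part[OF assms] has_derivative_inner_left has_derivative_ident)
  then show ?thesis
    unfolding slice_coord_def Complex_eq .
qed

text \<open>Moving within the slice does not turn the unit; an orthogonal displacement turns it at a
  rate inverse to the distance from the real axis.\<close>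

lemma has_derivative_sgn_im_part:
  assumes "im_part (q :: 'a) \<noteq> 0"
  shows "((\<lambda>p. sgn (im_part p)) has_derivative (\<lambda>h. (h - slice_proj q h) /\<^sub>R norm (im_part q))) (at q)"
proof -
  have im: "(im_part has_derivative im_part) (at q)"
    unfolding im_part_def by (auto intro!: derivative_eq_intros)
  have eq: "im_part (h :: 'a) = h - inner h 1 *\<^sub>R 1" for h
    by (simp add: im_part_def)
  have "norm (im_part q) \<noteq> 0"
    using assms by simp
  from has_derivative_scaleR[OF Deriv.has_derivative_inverse[OF this has_derivative_norm_im_part[OF assms]] im]
  have "((\<lambda>p. inverse (norm (im_part p)) *\<^sub>R im_part p) has_derivative
      (\<lambda>h. inverse (norm (im_part q)) *\<^sub>R im_part h +
        (- (inverse (norm (im_part q)) * inner h (sgn (im_part q)) * inverse (norm (im_part q)))) *\<^sub>R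
          im_part q)) (at q)" .
  then show ?thesis
    unfolding sgn_div_norm[symmetric]
  proof (rule has_derivative_eq_rhs, intro ext)
    fix h
    have "slice_proj q h = inner h 1 *\<^sub>R 1 +
        (inner h (sgn (im_part q)) * inverse (norm (im_part q))) *\<^sub>R im_part q"
      by (simp add: slice_proj_def) (simp add: sgn_div_norm)
    then show "inverse (norm (im_part q)) *\<^sub>R im_part h +
        (- (inverse (norm (im_part q)) * inner h (sgn (im_part q)) * inverse (norm (im_part q)))) *\<^sub>R
          im_part q = (h - slice_proj q h) /\<^sub>R norm (im_part q)"
      by (simp add: eq[of h] scaleR_diff_right scaleR_add_right ac_simps)
  qed
qed

text \<open>The bound is uniform in \<open>q\<close> and thus controls the projection near real
  points, where it is not continuous in \<open>q\<close>.\<close>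

lemma norm_slice_proj_le: "norm (slice_proj q (h :: 'a)) \<le> 2 * norm h"
proof -
  have s: "norm (sgn (im_part q)) \<le> 1"
    by (simp add: norm_sgn)
  have "norm (slice_proj q h) \<le> \<bar>inner h 1\<bar> * norm (1 :: 'a) +
      \<bar>inner h (sgn (im_part q))\<bar> * norm (sgn (im_part q))"
    unfolding slice_proj_def by (rule order_trans[OF norm_triangle_ineq]) simp
  also have "\<dots> \<le> norm h * 1 + (norm h * 1) * 1"
    using Cauchy_Schwarz_ineq2[of h 1] s
      order_trans[OF Cauchy_Schwarz_ineq2[of h "sgn (im_part q)"] mult_left_mono[OF s, of "norm h"]]
    by (intro add_mono mult_mono) (auto simp: norm_one)
  finally show ?thesis
    by simp
qed

lemma norm_sgn_mult_le: "norm (sgn u * (x :: 'a)) \<le> norm x"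
  by (simp add: norm_mult norm_sgn)

context
  fixes U \<alpha> \<beta> \<alpha>' \<beta>'
  assumes stem: "stem_pair U \<alpha> \<beta> \<alpha>' \<beta>'"
begin

lemma stem_open: "open U"
  and stem_cont: "continuous_on U \<alpha>'" "continuous_on U \<beta>'"
  and stem_real: "complex_of_real x \<in> U \<Longrightarrow> \<beta> (of_real x) = 0"
  and stem_deriv:
    "z \<in> U \<Longrightarrow> (\<alpha> has_derivative (\<lambda>h. Re h *\<^sub>R \<alpha>' z - Im h *\<^sub>R \<beta>' z)) (at z)"
    "z \<in> U \<Longrightarrow> (\<beta> has_derivative (\<lambda>h. Re h *\<^sub>R \<beta>' z + Im h *\<^sub>R \<alpha>' z)) (at z)"
  using stem by (auto simp: stem_pair_def)

text \<open>Along the real axis \<beta> is identically zero near \<open>r\<close>, hence so is its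
  derivative in that direction.\<close>

lemma stem_real_deriv:
  assumes r: "complex_of_real r \<in> U"
  shows "\<beta>' (of_real r) = 0"
proof -
  have "((\<lambda>t. \<beta> (complex_of_real t)) has_derivative
      (\<lambda>t. Re (of_real t) *\<^sub>R \<beta>' (of_real r) + Im (of_real t) *\<^sub>R \<alpha>' (of_real r))) (at r)"
    by (rule has_derivative_compose[where f = complex_of_real and g = \<beta>, OF _ stem_deriv(2)[OF r]])
      (intro has_derivative_of_real has_derivative_ident)
  then have "((\<lambda>t. \<beta> (complex_of_real t)) has_derivative (\<lambda>t. t *\<^sub>R \<beta>' (of_real r))) (at r)"
    by simp
  moreover have "((\<lambda>t. \<beta> (complex_of_real t)) has_derivative (\<lambda>t. 0)) (at r)"
  proof (rule has_derivative_transform_within_open[OF has_derivative_const])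
    show "open (complex_of_real -` U)"
      by (intro open_vimage stem_open continuous_intros)
  qed (use r stem_real in auto)
  ultimately have "(\<lambda>t. t *\<^sub>R \<beta>' (of_real r)) = (\<lambda>t. 0)"
    by (rule has_derivative_unique)
  then show ?thesis
    by (metis scaleR_one)
qed

text \<open>In the product rule the terms coming from the coordinate combine to a right
  multiplication, since applying the unit twice changes the sign. The part of \<open>h\<close>
  orthogonal to the slice enters only through the turning of the unit.\<close>

lemma stem_has_derivative_nonreal:
  assumes q: "slice_coord q \<in> U" and im: "im_part q \<noteq> 0"
  shows "((\<lambda>p. \<alpha> (slice_coord p) + sgn (im_part p) * \<beta> (slice_coord p)) has_derivative
     (\<lambda>h. slice_proj q h * stem_slice_deriv \<alpha>' \<beta>' q + (h - slice_proj q h) * stem_spherical_deriv \<alpha>' \<beta> q)) (at q)"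
proof -
  let ?z = "slice_coord q" and ?s = "sgn (im_part q)"
  have s: "?s * (?s * x) = - x" for x
    using imag_unit_mult_twice sgn_im_part_imag_units[OF im] by blast
  note dz = has_derivative_slice_coord[OF im]
  have "((\<lambda>p. \<alpha> (slice_coord p) + sgn (im_part p) * \<beta> (slice_coord p)) has_derivative
     (\<lambda>h. (Re (Complex (inner h 1) (inner h ?s)) *\<^sub>R \<alpha>' ?z - Im (Complex (inner h 1) (inner h ?s)) *\<^sub>R \<beta>' ?z) +
        (?s * (Re (Complex (inner h 1) (inner h ?s)) *\<^sub>R \<beta>' ?z + Im (Complex (inner h 1) (inner h ?s)) *\<^sub>R \<alpha>' ?z)
        + ((h - slice_proj q h) /\<^sub>R norm (im_part q)) * \<beta> ?z))) (at q)"
    by (intro has_derivative_add mult.FDERIV has_derivative_sgn_im_part[OF im]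
        has_derivative_compose[OF dz] stem_deriv q)
  then show ?thesis
    by (rule has_derivative_eq_rhs)
      (simp add: fun_eq_iff im stem_slice_deriv_def stem_spherical_deriv_def slice_proj_def[of q h for h] mult.add_left mult.add_right
        mult.diff_left mult.scaleR_left mult.scaleR_right mult_1_left s scaleR_add_right scaleR_diff_right)
qed

text \<open>The unit has no limit at a real point, so the product rule is replaced by adding the
  first order expansions of \<alpha> and \<beta>. Multiplying the remainder of \<beta> by the unit
  does not enlarge it.\<close>

lemma stem_has_derivative_real:
  assumes q: "slice_coord q \<in> U" and im: "im_part q = 0"
  shows "((\<lambda>p. \<alpha> (slice_coord p) + sgn (im_part p) * \<beta> (slice_coord p)) has_derivative
     (\<lambda>h. h * \<alpha>' (slice_coord q))) (at q)"
  unfolding has_derivative_at_alt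
proof (intro conjI allI impI)
  show "bounded_linear (\<lambda>h. h * \<alpha>' (slice_coord q))"
    by (rule mult.bounded_linear_left)
  define r where "r = inner q 1"
  have q_eq: "q = r *\<^sub>R 1"
    using im by (simp add: r_def im_part_def)
  have z: "slice_coord q = of_real r"
    using im by (simp add: complex_eq_iff r_def)
  have r: "of_real r \<in> U"
    using q z by simp
  note \<beta>'0 = stem_real_deriv[OF r]
  fix e :: real assume "e > 0"
  then have "e / 2 > 0" by simp
  then obtain d1 where d1: "d1 > 0" "\<And>w. norm (w - of_real r) < d1 \<Longrightarrow>
      norm (\<alpha> w - \<alpha> (of_real r) - Re (w - of_real r) *\<^sub>R \<alpha>' (of_real r)) \<le> e / 2 * norm (w - of_real r)"
    using stem_deriv(1)[OF r] \<beta>'0 unfolding has_derivative_at_alt by fastforce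
  obtain d2 where d2: "d2 > 0" "\<And>w. norm (w - of_real r) < d2 \<Longrightarrow>
      norm (\<beta> w - Im (w - of_real r) *\<^sub>R \<alpha>' (of_real r)) \<le> e / 2 * norm (w - of_real r)"
    using stem_deriv(2)[OF r] \<beta>'0 stem_real[OF r] \<open>e / 2 > 0\<close> unfolding has_derivative_at_alt by fastforce
  have "norm (\<alpha> (slice_coord p) + sgn (im_part p) * \<beta> (slice_coord p) -
        (\<alpha> (slice_coord q) + sgn (im_part q) * \<beta> (slice_coord q)) - (p - q) * \<alpha>' (slice_coord q))
      \<le> e * norm (p - q)" if p: "norm (p - q) < min d1 d2" for p
  proof -
    let ?w = "slice_coord p" and ?s = "sgn (im_part p)"
    \<comment> \<open>In these coordinates the linear terms of the two expansions recombine to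
      \<open>(p - q) * \<alpha>' (of_real r)\<close>.\<close>
    have pq: "p - q = Re (?w - of_real r) *\<^sub>R 1 + Im (?w - of_real r) *\<^sub>R ?s"
      using slice_point_sgn_im_part[of p] by (simp add: q_eq slice_point_def algebra_simps)
    have n: "norm (?w - of_real r) = norm (p - q)"
    proof (cases "im_part p = 0")
      case True
      then show ?thesis
        by (simp add: pq cmod_def norm_one)
    next
      case False
      then show ?thesis
        using norm_slice_point[OF sgn_im_part_imag_units[OF False],
            of "Re (?w - of_real r)" "Im (?w - of_real r)"]
        unfolding pq by (simp add: slice_point_def cmod_def)
    qed
    have "\<alpha> ?w + ?s * \<beta> ?w - (\<alpha> (slice_coord q) + sgn (im_part q) * \<beta> (slice_coord q)) - (p - q) * \<alpha>' (slice_coord q)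
      = (\<alpha> ?w - \<alpha> (of_real r) - Re (?w - of_real r) *\<^sub>R \<alpha>' (of_real r)) +
        ?s * (\<beta> ?w - Im (?w - of_real r) *\<^sub>R \<alpha>' (of_real r))"
      by (simp only: pq z im) (simp add: mult.add_left mult.scaleR_left mult.diff_right
          mult.scaleR_right mult_1_left mult.zero_left)
    also have "norm \<dots> \<le> e / 2 * norm (p - q) + e / 2 * norm (p - q)"
    proof (rule norm_triangle_mono)
      show "norm (\<alpha> ?w - \<alpha> (of_real r) - Re (?w - of_real r) *\<^sub>R \<alpha>' (of_real r)) \<le> e / 2 * norm (p - q)"
        using d1(2)[of ?w] p n by simp
      show "norm (?s * (\<beta> ?w - Im (?w - of_real r) *\<^sub>R \<alpha>' (of_real r))) \<le> e / 2 * norm (p - q)"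
        by (rule order_trans[OF norm_sgn_mult_le]) (use d2(2)[of ?w] p n in simp)
    qed
    finally show ?thesis
      by simp
  qed
  then show "\<exists>d>0. \<forall>p. norm (p - q) < d \<longrightarrow>
      norm (\<alpha> (slice_coord p) + sgn (im_part p) * \<beta> (slice_coord p) -
        (\<alpha> (slice_coord q) + sgn (im_part q) * \<beta> (slice_coord q)) - (p - q) * \<alpha>' (slice_coord q))
      \<le> e * norm (p - q)"
    using d1(1) d2(1) by (intro exI[of _ "min d1 d2"]) auto
qed

lemma stem_has_derivative:
  assumes q: "slice_coord q \<in> U"
  shows "((\<lambda>p. \<alpha> (slice_coord p) + sgn (im_part p) * \<beta> (slice_coord p)) has_derivative
     (\<lambda>h. slice_proj q h * stem_slice_deriv \<alpha>' \<beta>' q + (h - slice_proj q h) * stem_spherical_deriv \<alpha>' \<beta> q)) (at q)"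
proof (cases "im_part q = 0")
  case True
  then have "stem_slice_deriv \<alpha>' \<beta>' q = \<alpha>' (slice_coord q)" "stem_spherical_deriv \<alpha>' \<beta> q = \<alpha>' (slice_coord q)"
    by (simp_all add: stem_slice_deriv_def stem_spherical_deriv_def mult.zero_left)
  then show ?thesis
    using stem_has_derivative_real[OF q True] by (simp flip: mult.add_left)
qed (rule stem_has_derivative_nonreal[OF q])

end

section \<open>Continuity of the differential\<close>

lemma isCont_slice_coord: "isCont slice_coord (q :: 'a)"
  using continuous_slice_coord[of "UNIV :: 'a set"] by (simp add: continuous_on_eq_continuous_at)

lemma isCont_stem_comp:
  assumes "open U" "continuous_on U F" "slice_coord (q :: 'a) \<in> U"
  shows "isCont (\<lambda>p. F (slice_coord p) :: 'a) q"
  using assms by (intro isCont_o2[OF isCont_slice_coord]) (simp add: continuous_on_eq_continuous_at)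

text \<open>As \<beta> vanishes on the real axis, the mean value inequality on the vertical segment
  from the real axis to the coordinate of \<open>p\<close> compares the quotient defining the
  spherical derivative with \<open>\<alpha>'\<close> at the limit point.\<close>

lemma isCont_stem_spherical_deriv:
  assumes stem: "stem_pair U \<alpha> \<beta> \<alpha>' \<beta>'" and q: "slice_coord (q :: 'a) \<in> U" and im: "im_part q = 0"
  shows "isCont (stem_spherical_deriv \<alpha>' \<beta>) q"
  unfolding continuous_at_eps_delta
proof (intro allI impI)
  fix e :: real assume e: "e > 0"
  define r where "r = inner q 1"
  have z: "slice_coord q = of_real r"
    using im by (simp add: complex_eq_iff r_def)
  have r: "of_real r \<in> U"
    using q z by simp
  note op = stem_open[OF stem]
  have "isCont \<alpha>' (of_real r)" "isCont \<beta>' (of_real r)"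
    using stem_cont[OF stem] op r by (simp_all add: continuous_on_eq_continuous_at)
  moreover have "\<forall>\<^sub>F w in nhds (of_real r). F w \<in> ball (F (of_real r)) (e / 3)"
    if "isCont F (of_real r)" for F :: "complex \<Rightarrow> 'a"
    by (rule isCont_eventually_nhds[OF that]) (use e in simp_all)
  ultimately have "\<forall>\<^sub>F w in nhds (of_real r). \<alpha>' w \<in> ball (\<alpha>' (of_real r)) (e / 3)"
    "\<forall>\<^sub>F w in nhds (of_real r). \<beta>' w \<in> ball (\<beta>' (of_real r)) (e / 3)"
    by blast+
  moreover have "\<forall>\<^sub>F w in nhds (of_real r). w \<in> U"
    using op r by (rule eventually_nhds_in_open)
  ultimately have "\<forall>\<^sub>F w in nhds (of_real r). w \<in> U \<and> dist (\<alpha>' w) (\<alpha>' (of_real r)) < e / 3 \<and>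
      dist (\<beta>' w) (\<beta>' (of_real r)) < e / 3"
    by eventually_elim (auto simp: dist_commute)
  then obtain d where d: "d > 0" "\<And>w. dist w (of_real r) < d \<Longrightarrow>
      w \<in> U \<and> dist (\<alpha>' w) (\<alpha>' (of_real r)) < e / 3 \<and> dist (\<beta>' w) (\<beta>' (of_real r)) < e / 3"
    unfolding eventually_nhds_metric by blast
  obtain d' where d': "d' > 0" "\<And>p. dist p q < d' \<Longrightarrow> dist (slice_coord p) (of_real r) < d"
    using isCont_slice_coord[of q] d(1) unfolding continuous_at_eps_delta z by blast
  have bq: "stem_spherical_deriv \<alpha>' \<beta> q = \<alpha>' (of_real r)"
    using im z by (simp add: stem_spherical_deriv_def)
  have "dist (stem_spherical_deriv \<alpha>' \<beta> p) (stem_spherical_deriv \<alpha>' \<beta> q) < e" if "dist p q < d'" for p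
  proof (cases "im_part p = 0")
    case True
    then show ?thesis
      using d(2)[OF d'(2)[OF that]] e by (simp add: bq) (simp add: stem_spherical_deriv_def)
  next
    case False
    \<comment> \<open>The point \<open>x\<close> is the foot of \<open>w\<close> on the real axis;
      it is no farther from \<open>r\<close> than \<open>w\<close> is.\<close>
    define w x n where "w = slice_coord p" and "x = complex_of_real (inner p 1)" and "n = norm (im_part p)"
    have n: "n > 0"
      using False by (simp add: n_def)
    have w: "w = Complex (inner p 1) n" and wx: "w - x = Complex 0 n"
      by (simp_all add: w_def x_def n_def complex_eq_iff)
    have w_in: "dist w (of_real r) < d"
      using d'(2)[OF that] by (simp add: w_def)
    have "dist x (of_real r) \<le> dist w (of_real r)"
      using abs_Re_le_cmod[of "w - of_real r"]
      by (simp add: dist_norm x_def w norm_of_real flip: of_real_diff)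
    then have x_in: "dist x (of_real r) < d"
      using w_in by simp
    let ?S = "ball (complex_of_real r) d"
    let ?B' = "\<lambda>w h. Re h *\<^sub>R \<beta>' w + Im h *\<^sub>R \<alpha>' w"
    \<comment> \<open>On the ball the derivative of \<beta> deviates from the one at
      \<open>r\<close> by at most \<open>2 * e / 3\<close>, a third of \<open>e\<close> for each
      partial derivative. Since \<open>w - x\<close> is purely imaginary, the linear term is
      \<open>n\<close> times \<open>\<alpha>' (of_real r)\<close>.\<close>
    have "norm (\<beta> w - \<beta> x - ?B' (of_real r) (w - x)) \<le> norm (w - x) * (2 * e / 3)"
    proof (rule differentiable_bound_linearization[where S = ?S and f' = ?B'])
      show "x + t *\<^sub>R (w - x) \<in> ?S" if "t \<in> {0..1}" for t
      proof -
        have "(1 - t) *\<^sub>R x + t *\<^sub>R w \<in> ?S"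
          using w_in x_in that by (intro convexD[OF convex_ball]) (auto simp: dist_commute)
        then show ?thesis
          by (simp add: algebra_simps)
      qed
      show "of_real r \<in> ?S"
        using d(1) by simp
      fix v assume v: "v \<in> ?S"
      then have v': "v \<in> U" "norm (\<alpha>' v - \<alpha>' (of_real r)) < e / 3" "norm (\<beta>' v - \<beta>' (of_real r)) < e / 3"
        using d(2)[of v] by (auto simp: dist_commute dist_norm)
      show "(\<beta> has_derivative ?B' v) (at v within ?S)"
        by (rule has_derivative_at_withinI[OF stem_deriv(2)[OF stem v'(1)]])
      have "norm (?B' v h - ?B' (of_real r) h) \<le> norm h * (2 * e / 3)" for h
      proof -
        have "?B' v h - ?B' (of_real r) h =
            Re h *\<^sub>R (\<beta>' v - \<beta>' (of_real r)) + Im h *\<^sub>R (\<alpha>' v - \<alpha>' (of_real r))"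
          by (simp add: algebra_simps)
        also have "norm \<dots> \<le> norm h * (e / 3) + norm h * (e / 3)"
        proof (rule norm_triangle_mono)
          show "norm (Re h *\<^sub>R (\<beta>' v - \<beta>' (of_real r))) \<le> norm h * (e / 3)"
            unfolding norm_scaleR using v'(3) abs_Re_le_cmod[of h] by (intro mult_mono) auto
          show "norm (Im h *\<^sub>R (\<alpha>' v - \<alpha>' (of_real r))) \<le> norm h * (e / 3)"
            unfolding norm_scaleR using v'(2) abs_Im_le_cmod[of h] by (intro mult_mono) auto
        qed
        finally show ?thesis
          by (simp add: algebra_simps)
      qed
      then show "onorm (?B' v - ?B' (of_real r)) \<le> 2 * e / 3"
        by (intro onorm_le) (simp add: ac_simps)
    qed
    moreover have "\<beta> x = 0"
      using stem_real[OF stem] d(2)[OF x_in] by (simp add: x_def)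
    ultimately have "norm (\<beta> w - n *\<^sub>R \<alpha>' (of_real r)) \<le> n * (2 * e / 3)"
      using n by (simp add: wx cmod_def)
    moreover have "\<beta> w - n *\<^sub>R \<alpha>' (of_real r) = n *\<^sub>R (stem_spherical_deriv \<alpha>' \<beta> p - stem_spherical_deriv \<alpha>' \<beta> q)"
      using n False by (simp add: bq scaleR_diff_right) (simp add: stem_spherical_deriv_def w_def n_def)
    ultimately have "norm (stem_spherical_deriv \<alpha>' \<beta> p - stem_spherical_deriv \<alpha>' \<beta> q) \<le> 2 * e / 3"
      using n by simp
    then show ?thesis
      using e by (simp add: dist_norm)
  qed
  then show "\<exists>d>0. \<forall>p. dist p q < d \<longrightarrow> dist (stem_spherical_deriv \<alpha>' \<beta> p) (stem_spherical_deriv \<alpha>' \<beta> q) < e"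
    using d'(1) by blast
qed

lemma isCont_sgn_im_part: "im_part (q :: 'a) \<noteq> 0 \<Longrightarrow> isCont (\<lambda>p. sgn (im_part p)) q"
  by (rule has_derivative_continuous[OF has_derivative_sgn_im_part])

text \<open>At a real point the projection is discontinuous in \<open>p\<close>, but the slice and
  spherical derivatives have the same limit. Rewriting the expression as the projection of
  \<open>h\<close> times their difference, plus \<open>h\<close> times the spherical derivative,
  leaves a bounded factor times one that tends to 0.\<close>

lemma isCont_stem_derivative:
  assumes stem: "stem_pair U \<alpha> \<beta> \<alpha>' \<beta>'" and q: "slice_coord (q :: 'a) \<in> U"
  shows "isCont (\<lambda>p. slice_proj p h * stem_slice_deriv \<alpha>' \<beta>' p + (h - slice_proj p h) * stem_spherical_deriv \<alpha>' \<beta> p) q"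
proof -
  note op = stem_open[OF stem]
  note c = isCont_stem_comp[OF op _ q]
  have ca: "isCont (\<lambda>p. \<alpha>' (slice_coord p)) q" and cb: "isCont (\<lambda>p. \<beta>' (slice_coord p)) q"
    using stem_cont[OF stem] c by auto
  show ?thesis
  proof (cases "im_part q = 0")
    case False
    note cs = isCont_sgn_im_part[OF False]
    have P: "isCont (\<lambda>p. slice_proj p h) q"
      unfolding slice_proj_def by (intro continuous_intros cs)
    have "continuous_on U \<beta>"
      using stem_deriv(2)[OF stem] by (meson continuous_at_imp_continuous_on has_derivative_continuous)
    then have "isCont (\<lambda>p. \<beta> (slice_coord p)) q"
      by (rule c)
    moreover have "isCont (\<lambda>p. norm (im_part p)) q"
      unfolding im_part_def by (intro continuous_intros)
    ultimately have B: "isCont (\<lambda>p. \<beta> (slice_coord p) /\<^sub>R norm (im_part p)) q"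
      using False by (intro continuous_scaleR continuous_at_within_inverse) auto
    have "isCont im_part q"
      unfolding im_part_def by (intro continuous_intros)
    then have "\<forall>\<^sub>F p in nhds q. im_part p \<in> - {0}"
      using False by (intro isCont_eventually_nhds) auto
    then have "\<forall>\<^sub>F p in nhds q. stem_spherical_deriv \<alpha>' \<beta> p = \<beta> (slice_coord p) /\<^sub>R norm (im_part p)"
      by eventually_elim (simp add: stem_spherical_deriv_def)
    then have "isCont (stem_spherical_deriv \<alpha>' \<beta>) q"
      using B by (simp add: isCont_cong)
    moreover have "isCont (stem_slice_deriv \<alpha>' \<beta>') q"
      unfolding stem_slice_deriv_def by (intro continuous_add mult.continuous ca cb cs)
    ultimately show ?thesis
      by (intro continuous_add continuous_diff mult.continuous P continuous_const)
  next
    case True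
    then have z: "slice_coord q = of_real (inner q 1)"
      by (simp add: complex_eq_iff)
    have b0: "\<beta>' (slice_coord q) = 0"
      using stem_real_deriv[OF stem] q z by metis
    have tb: "(stem_spherical_deriv \<alpha>' \<beta> \<longlongrightarrow> \<alpha>' (slice_coord q)) (at q)"
      using isCont_stem_spherical_deriv[OF stem q True] True by (simp add: isCont_def stem_spherical_deriv_def)
    \<comment> \<open>The unit has norm at most 1, and \<open>\<beta>'\<close> tends to its value 0
      at the real point.\<close>
    have "((\<lambda>p. sgn (im_part p) * \<beta>' (slice_coord p)) \<longlongrightarrow> 0) (at q)"
    proof (rule Lim_null_comparison)
      show "\<forall>\<^sub>F p in at q. norm (sgn (im_part p) * \<beta>' (slice_coord p)) \<le> norm (\<beta>' (slice_coord p))"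
        by (intro always_eventually allI norm_sgn_mult_le)
      show "((\<lambda>p. norm (\<beta>' (slice_coord p))) \<longlongrightarrow> 0) (at q)"
        using cb b0 by (simp add: isCont_def tendsto_norm_zero)
    qed
    then have "((\<lambda>p. \<alpha>' (slice_coord p) + sgn (im_part p) * \<beta>' (slice_coord p)) \<longlongrightarrow> \<alpha>' (slice_coord q) + 0) (at q)"
      using ca by (intro tendsto_add) (auto simp: isCont_def)
    then have "(stem_slice_deriv \<alpha>' \<beta>' \<longlongrightarrow> \<alpha>' (slice_coord q)) (at q)"
      by (simp add: stem_slice_deriv_def[abs_def])
    from tendsto_diff[OF this tb]
    have cb0: "((\<lambda>p. stem_slice_deriv \<alpha>' \<beta>' p - stem_spherical_deriv \<alpha>' \<beta> p) \<longlongrightarrow> 0) (at q)"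
      by simp
    have "((\<lambda>p. slice_proj p h * (stem_slice_deriv \<alpha>' \<beta>' p - stem_spherical_deriv \<alpha>' \<beta> p)) \<longlongrightarrow> 0) (at q)"
    proof (rule Lim_null_comparison)
      show "\<forall>\<^sub>F p in at q. norm (slice_proj p h * (stem_slice_deriv \<alpha>' \<beta>' p - stem_spherical_deriv \<alpha>' \<beta> p))
          \<le> 2 * norm h * norm (stem_slice_deriv \<alpha>' \<beta>' p - stem_spherical_deriv \<alpha>' \<beta> p)"
        by (intro always_eventually allI) (auto simp: norm_mult intro!: mult_right_mono norm_slice_proj_le)
      show "((\<lambda>p. 2 * norm h * norm (stem_slice_deriv \<alpha>' \<beta>' p - stem_spherical_deriv \<alpha>' \<beta> p)) \<longlongrightarrow> 0) (at q)"
        by (intro tendsto_mult_right_zero tendsto_norm_zero cb0)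
    qed
    moreover have "((\<lambda>p. h * stem_spherical_deriv \<alpha>' \<beta> p) \<longlongrightarrow> h * \<alpha>' (slice_coord q)) (at q)"
      by (intro mult.tendsto tendsto_const tb)
    ultimately have "((\<lambda>p. slice_proj p h * (stem_slice_deriv \<alpha>' \<beta>' p - stem_spherical_deriv \<alpha>' \<beta> p) + h * stem_spherical_deriv \<alpha>' \<beta> p)
        \<longlongrightarrow> 0 + h * \<alpha>' (slice_coord q)) (at q)"
      by (rule tendsto_add)
    moreover have "stem_slice_deriv \<alpha>' \<beta>' q = \<alpha>' (slice_coord q)" "stem_spherical_deriv \<alpha>' \<beta> q = \<alpha>' (slice_coord q)"
      using True by (simp_all add: stem_slice_deriv_def stem_spherical_deriv_def mult.zero_left)
    ultimately show ?thesis
      by (simp add: isCont_def mult.diff_left mult.diff_right algebra_simps)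
  qed
qed

text \<open>The coefficients are functions on a neighbourhood, because continuity of the derivative
  compares nearby points. Their equality at real \<open>q\<close> is recorded since
  \<open>slice_proj q\<close> then projects only onto the real line.\<close>

lemma has_local_stem_derivative:
  assumes "has_local_stem g (q0 :: 'a)"
  shows "\<exists>c b. (\<forall>\<^sub>F q in nhds q0. (im_part q = 0 \<longrightarrow> c q = b q) \<and>
      (g has_derivative (\<lambda>h. slice_proj q h * c q + (h - slice_proj q h) * b q)) (at q)) \<and>
    (\<forall>h. isCont (\<lambda>q. slice_proj q h * c q + (h - slice_proj q h) * b q) q0)"
proof -
  obtain U \<alpha> \<beta> \<alpha>' \<beta>' where stem: "stem_pair U \<alpha> \<beta> \<alpha>' \<beta>'" and q0: "slice_coord q0 \<in> U" and
    rep: "\<forall>\<^sub>F q in nhds q0. g q = \<alpha> (slice_coord q) + sgn (im_part q) * \<beta> (slice_coord q)"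
    using assms unfolding has_local_stem_def by blast
  \<comment> \<open>The representation near \<open>q0\<close> also holds near each point close to
    \<open>q0\<close>, so it can be differentiated there.\<close>
  have "\<forall>\<^sub>F q in nhds q0. \<forall>\<^sub>F p in nhds q. g p = \<alpha> (slice_coord p) + sgn (im_part p) * \<beta> (slice_coord p)"
    using rep by (simp add: eventually_eventually)
  moreover have "\<forall>\<^sub>F q in nhds q0. slice_coord q \<in> U"
    by (rule isCont_eventually_nhds[OF isCont_slice_coord stem_open[OF stem] q0])
  ultimately have "\<forall>\<^sub>F q in nhds q0. (im_part q = 0 \<longrightarrow> stem_slice_deriv \<alpha>' \<beta>' q = stem_spherical_deriv \<alpha>' \<beta> q) \<and>
      (g has_derivative (\<lambda>h. slice_proj q h * stem_slice_deriv \<alpha>' \<beta>' q +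
        (h - slice_proj q h) * stem_spherical_deriv \<alpha>' \<beta> q)) (at q)"
  proof eventually_elim
    case (elim q)
    from elim(1) obtain S where S: "open S" "q \<in> S"
        "\<And>p. p \<in> S \<Longrightarrow> g p = \<alpha> (slice_coord p) + sgn (im_part p) * \<beta> (slice_coord p)"
      unfolding eventually_nhds by blast
    have "(g has_derivative (\<lambda>h. slice_proj q h * stem_slice_deriv \<alpha>' \<beta>' q +
        (h - slice_proj q h) * stem_spherical_deriv \<alpha>' \<beta> q)) (at q)"
      by (rule has_derivative_transform_within_open[OF stem_has_derivative[OF stem elim(2)] S(1,2)])
        (simp add: S(3))
    then show ?case
      by (simp add: stem_slice_deriv_def stem_spherical_deriv_def mult.zero_left)
  qed
  then show ?thesis
    using isCont_stem_derivative[OF stem q0] by blast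
qed

lemma has_local_stem_differentiable:
  assumes "has_local_stem g (q :: 'a)"
  shows "g differentiable (at q)"
proof -
  obtain c b where "\<forall>\<^sub>F q in nhds q. (im_part q = 0 \<longrightarrow> c q = b q) \<and>
      (g has_derivative (\<lambda>h. slice_proj q h * c q + (h - slice_proj q h) * b q)) (at q)"
    using has_local_stem_derivative[OF assms] by blast
  from eventually_nhds_x_imp_x[OF this] show ?thesis
    by (blast intro: differentiableI)
qed

lemma has_local_stem_isCont_derivative:
  assumes "has_local_stem g (q :: 'a)"
  shows "isCont (\<lambda>p. frechet_derivative g (at p) h) q"
proof -
  obtain c b where
    D: "\<forall>\<^sub>F q in nhds q. (im_part q = 0 \<longrightarrow> c q = b q) \<and>
      (g has_derivative (\<lambda>h. slice_proj q h * c q + (h - slice_proj q h) * b q)) (at q)"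
    and C: "\<And>h. isCont (\<lambda>q. slice_proj q h * c q + (h - slice_proj q h) * b q) q"
    using has_local_stem_derivative[OF assms] by blast
  have "\<forall>\<^sub>F p in nhds q. frechet_derivative g (at p) h = slice_proj p h * c p + (h - slice_proj p h) * b p"
    using D
  proof eventually_elim
    case (elim p)
    then show ?case
      using fun_cong[OF frechet_derivative_at, of g _ p h] by fastforce
  qed
  then show ?thesis
    using C[of h] by (simp add: isCont_cong)
qed

text \<open>Off the real axis \<open>slice_proj\<close> is the orthogonal projection onto the slice
  plane, so one of the two terms of the derivative drops out on each subspace.\<close>

lemma has_local_stem_frechet:
  assumes g: "has_local_stem g (slice_point I x y)" and I: "(I :: 'a) \<in> imag_units"
  shows "\<exists>c b. (\<forall>h\<in>slice_plane I. frechet_derivative g (at (slice_point I x y)) h = h * c) \<and>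
    (\<forall>h\<in>(slice_plane I)\<^sup>\<bottom>. frechet_derivative g (at (slice_point I x y)) h = h * b)"
proof -
  let ?q = "slice_point I x y"
  obtain c b where "\<forall>\<^sub>F q in nhds ?q. (im_part q = 0 \<longrightarrow> c q = b q) \<and>
      (g has_derivative (\<lambda>h. slice_proj q h * c q + (h - slice_proj q h) * b q)) (at q)"
    using has_local_stem_derivative[OF g] by blast
  from eventually_nhds_x_imp_x[OF this]
  have cb: "im_part ?q = 0 \<Longrightarrow> c ?q = b ?q" and
      D: "(g has_derivative (\<lambda>h. slice_proj ?q h * c ?q + (h - slice_proj ?q h) * b ?q)) (at ?q)"
    by simp_all
  have D': "frechet_derivative g (at ?q) h = slice_proj ?q h * c ?q + (h - slice_proj ?q h) * b ?q" for h
    using fun_cong[OF frechet_derivative_at[OF D], of h] by simp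
  have I': "inner I 1 = 0" "inner 1 I = 0" "inner I I = 1" "norm I = 1" "I \<noteq> 0"
    using I by (auto simp: imag_units_iff dot_square_norm inner_commute)
  have im: "im_part ?q = y *\<^sub>R I"
    by (rule im_part_slice_point[OF I])
  show ?thesis
  proof (cases "y = 0")
    \<comment> \<open>At a real point the two coefficients agree, and the derivative is a single
      right multiplication on the whole algebra, whatever \<open>I\<close> is.\<close>
    case True
    then have "c ?q = b ?q"
      using cb im by simp
    then have "frechet_derivative g (at ?q) h = h * c ?q" for h
      using mult.add_left[of "slice_proj ?q h" "h - slice_proj ?q h" "b ?q"] unfolding D' by simp
    then show ?thesis
      by blast
  next
    case False
    \<comment> \<open>For negative \<open>y\<close> the unit of the point is \<open>- I\<close>; the
      sign cancels in the projection.\<close>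
    then have P: "slice_proj ?q h = inner h 1 *\<^sub>R 1 + inner h I *\<^sub>R I" for h
      by (simp add: slice_proj_def im sgn_div_norm I' abs_if)
    have "slice_proj ?q h = h" if "h \<in> slice_plane I" for h
      using that unfolding P
      by (auto simp: slice_plane_def slice_point_def inner_add_left inner_one_one I')
    moreover have "slice_proj ?q h = 0" if "h \<in> (slice_plane I)\<^sup>\<bottom>" for h
    proof -
      have "slice_point I 1 0 \<in> slice_plane I" "slice_point I 0 1 \<in> slice_plane I"
        by (auto simp: slice_plane_def)
      then have "inner h 1 = 0" "inner h I = 0"
        using that by (auto simp: orthogonal_comp_def orthogonal_def slice_point_def inner_commute)
      then show ?thesis
        by (simp add: P)
    qed
    ultimately show ?thesis
      by (intro exI[of _ "c ?q"] exI[of _ "b ?q"]) (simp add: D' mult.zero_left)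
  qed
qed

lemma subspace_slice_plane: "subspace (slice_plane (I :: 'a))"
proof (rule subspaceI)
  have "0 = slice_point I 0 0"
    by (simp add: slice_point_def)
  then show "0 \<in> slice_plane I"
    unfolding slice_plane_def by blast
next
  fix u v assume "u \<in> slice_plane I" "v \<in> slice_plane I"
  then obtain x y x' y' where "u = slice_point I x y" "v = slice_point I x' y'"
    unfolding slice_plane_def by blast
  then have "u + v = slice_point I (x + x') (y + y')"
    by (simp add: slice_point_def algebra_simps)
  then show "u + v \<in> slice_plane I"
    unfolding slice_plane_def by blast
next
  fix c u assume "u \<in> slice_plane I"
  then obtain x y where "u = slice_point I x y"
    unfolding slice_plane_def by blast
  then have "c *\<^sub>R u = slice_point I (c * x) (c * y)"
    by (simp add: slice_point_def scaleR_add_right)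
  then show "c *\<^sub>R u \<in> slice_plane I"
    unfolding slice_plane_def by blast
qed

section \<open>Slice regular curves and graphs\<close>

text \<open>On each of the two subspaces both components of the differential are right
  multiplications. The pair could fail to be conformal only if both multipliers vanished, which the
  immersion property excludes.\<close>

lemma slice_regular_curve_slice_conformal:
  fixes f :: "'a \<Rightarrow> 'a \<times> 'a"
  assumes \<Omega>: "slice_domain \<Omega>" and f: "slice_regular_curve \<Omega> f"
  shows "slice_conformal \<Omega> f"
  unfolding slice_conformal_def
proof (intro conjI ballI allI impI)
  let ?g = "\<lambda>q. fst (f q)" and ?h = "\<lambda>q. snd (f q)"
  have stem: "has_local_stem ?g q" "has_local_stem ?h q" if "q \<in> \<Omega>" for q
    using slice_domain_has_local_stem[OF \<Omega> _ that] f by (auto simp: slice_regular_curve_def)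
  note diff = has_local_stem_differentiable[OF stem(1)] has_local_stem_differentiable[OF stem(2)]
  note pair = frechet_derivative_Pair[OF diff]
  have op: "open \<Omega>"
    using \<Omega> by (simp add: slice_domain_def)
  show "C1_on \<Omega> f"
  proof (rule C1_onI[OF _ _ op])
    fix q h assume q: "q \<in> \<Omega>"
    show "f differentiable (at q)"
      using pair(1) q by blast
    have "isCont (\<lambda>p. (frechet_derivative ?g (at p) h, frechet_derivative ?h (at p) h)) q"
      using stem[OF q] by (intro continuous_Pair has_local_stem_isCont_derivative)
    moreover have "\<forall>\<^sub>F p in nhds q. frechet_derivative f (at p) h =
        (frechet_derivative ?g (at p) h, frechet_derivative ?h (at p) h)"
      using eventually_nhds_in_open[OF op q] by eventually_elim (rule pair(2))
    ultimately show "isCont (\<lambda>p. frechet_derivative f (at p) h) q"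
      by (simp add: isCont_cong)
  qed
  fix I :: 'a and x y assume I: "I \<in> imag_units" and q: "slice_point I x y \<in> \<Omega>"
  let ?T = "frechet_derivative f (at (slice_point I x y))"
  have "f differentiable (at (slice_point I x y))" and inj: "inj ?T"
    using f q by (auto simp: slice_regular_curve_def immersion_on_def)
  then have lin: "linear ?T"
    by (intro linear_frechet_derivative)
  obtain c1 b1 where 1:
    "\<And>h. h \<in> slice_plane I \<Longrightarrow> frechet_derivative ?g (at (slice_point I x y)) h = h * c1"
    "\<And>h. h \<in> (slice_plane I)\<^sup>\<bottom> \<Longrightarrow> frechet_derivative ?g (at (slice_point I x y)) h = h * b1"
    using has_local_stem_frechet[OF stem(1)[OF q] I] by blast
  obtain c2 b2 where 2:
    "\<And>h. h \<in> slice_plane I \<Longrightarrow> frechet_derivative ?h (at (slice_point I x y)) h = h * c2"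
    "\<And>h. h \<in> (slice_plane I)\<^sup>\<bottom> \<Longrightarrow> frechet_derivative ?h (at (slice_point I x y)) h = h * b2"
    using has_local_stem_frechet[OF stem(2)[OF q] I] by blast
  \<comment> \<open>A nonzero vector is needed in each subspace to see that the conformal factor is
    nonzero: here \<open>1\<close>, and below a unit vector orthogonal to \<open>1\<close> and
    \<open>I\<close>.\<close>
  have "slice_point I 1 0 \<in> slice_plane I"
    unfolding slice_plane_def by blast
  moreover have "slice_point I 1 0 \<noteq> 0"
    using norm_slice_point[OF I, of 1 0] by (auto simp: cmod_def)
  ultimately show "conformal_on (slice_plane I) ?T"
    by (rule conformal_on_right_mult[OF subspace_slice_plane lin inj])
      (simp add: pair(2)[OF q q] 1 2)
  obtain v :: 'a where v: "norm v = 1" "inner v 1 = 0" "inner v I = 0"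
    using ex_orthogonal_unit by blast
  then have "v \<in> (slice_plane I)\<^sup>\<bottom>" "v \<noteq> 0"
    by (auto simp: orthogonal_comp_def orthogonal_def slice_plane_def slice_point_def
        inner_add_right inner_commute)
  then show "conformal_on ((slice_plane I)\<^sup>\<bottom>) ?T"
    by (rule conformal_on_right_mult[OF subspace_orthogonal_comp lin inj])
      (simp add: pair(2)[OF q q] 1 2)
next
  show "slice_domain \<Omega>"
    by (rule \<Omega>)
  show "DIM('a) \<le> DIM('a \<times> 'a)"
    by simp
qed

lemma slice_regular_curve_parameterization:
  fixes f :: "'a \<Rightarrow> 'a \<times> 'a"
  assumes "slice_domain \<Omega>" "slice_regular_curve \<Omega> f" "inj_on f \<Omega>"
  shows "slice_conformal_parameterization \<Omega> f"
  using slice_regular_curve_slice_conformal[OF assms(1,2)] assms(2,3)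
  by (simp add: slice_conformal_parameterization_def slice_regular_curve_def)

lemma slice_regular_on_ident: "slice_regular_on \<Omega> (\<lambda>q :: 'a. q)"
  unfolding slice_regular_on_def
proof
  fix I :: 'a assume I: "I \<in> imag_units"
  then have "1 + I * I = 0"
    by (simp add: imag_units_def)
  moreover have "((\<lambda>t. slice_point I t y) has_vector_derivative 1) (at x)"
    "((\<lambda>t. slice_point I x t) has_vector_derivative I) (at y)" for x y
    unfolding slice_point_def by (auto intro!: derivative_eq_intros)
  ultimately show "\<exists>gx gy. continuous_on (\<Omega> \<inter> slice_plane I) gx \<and> continuous_on (\<Omega> \<inter> slice_plane I) gy \<and>
        (\<forall>x y. slice_point I x y \<in> \<Omega> \<longrightarrow>
           ((\<lambda>t. slice_point I t y) has_vector_derivative gx (slice_point I x y)) (at x) \<and>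
           ((\<lambda>t. slice_point I x t) has_vector_derivative gy (slice_point I x y)) (at y) \<and>
           (1/2) *\<^sub>R (gx (slice_point I x y) + I * gy (slice_point I x y)) = 0)"
    by (intro exI[of _ "\<lambda>_. 1"] exI[of _ "\<lambda>_. I"]) simp
qed

text \<open>The identity in the first component makes the differential injective. Slice regularity
  speaks only of restrictions to slices, so full differentiability of \<open>g\<close> is drawn from
  its local stem.\<close>

lemma slice_regular_curve_graph:
  assumes \<Omega>: "slice_domain \<Omega>" and g: "slice_regular_on \<Omega> (g :: 'a \<Rightarrow> 'a)"
  shows "slice_regular_curve \<Omega> (\<lambda>q. (q, g q))"
  unfolding slice_regular_curve_def immersion_on_def
proof (intro conjI ballI)
  fix q assume "q \<in> \<Omega>"
  then have "g differentiable (at q)"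
    by (intro has_local_stem_differentiable slice_domain_has_local_stem[OF \<Omega> g])
  then have 1: "(\<lambda>p. fst (p, g p)) differentiable (at q)" "(\<lambda>p. snd (p, g p)) differentiable (at q)"
    by simp_all
  note pair = frechet_derivative_Pair[OF 1]
  show "(\<lambda>q. (q, g q)) differentiable (at q)"
    by (rule pair(1))
  show "inj (frechet_derivative (\<lambda>q. (q, g q)) (at q))"
    using pair(2) by (auto intro!: injI simp: frechet_derivative_ident)
qed (use g slice_regular_on_ident in simp_all)

lemma slice_regular_graph_manifold:
  assumes "slice_domain \<Omega>" "slice_regular_on \<Omega> (g :: 'a \<Rightarrow> 'a)"
  shows "parameterized_hypercomplex_Riemann_manifold TYPE('a) {(q, g q) | q. q \<in> \<Omega>}"
proof -
  have "slice_conformal_parameterization \<Omega> (\<lambda>q. (q, g q))"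
    by (rule slice_regular_curve_parameterization[OF assms(1) slice_regular_curve_graph[OF assms]])
      (simp add: inj_on_def)
  moreover have "{(q, g q) | q. q \<in> \<Omega>} = (\<lambda>q. (q, g q)) ` \<Omega>"
    by auto
  ultimately show ?thesis
    unfolding parameterized_hypercomplex_Riemann_manifold_def by blast
qed

end

section \<open>Quaternions and octonions as composition algebras\<close>

interpretation quat: composition_algebra "TYPE(quat)"
proof
  show "\<exists>K. \<forall>a b :: quat. norm (a * b) \<le> norm a * norm b * K"
    by (intro exI[of _ 1]) (simp add: norm_mult_quat)
  show "(a + a') * b = a * b + a' * b" "a * (b + b') = a * b + a * b'"
    "(r *\<^sub>R a) * b = r *\<^sub>R (a * b)" "a * (r *\<^sub>R b) = r *\<^sub>R (a * b)" for a a' b b' :: quat and r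
    by (simp_all add: times_cd_def plus_cd_def minus_cd_def scaleR_cd_def algebra_simps)
  show "1 * x = x" "x * 1 = x" for x :: quat
    by (simp_all add: cd_eq_iff times_cd_def one_cd_def)
qed (simp_all add: norm_mult_quat DIM_quat)

lemma cd_sel_simps:
  "cd_fst (x + y) = cd_fst x + cd_fst y" "cd_snd (x + y) = cd_snd x + cd_snd y"
  "cd_fst (r *\<^sub>R z) = r *\<^sub>R cd_fst z" "cd_snd (r *\<^sub>R z) = r *\<^sub>R cd_snd z"
  by (simp_all add: plus_cd_def scaleR_cd_def)

lemma conj_quat_simps:
  fixes x y :: quat
  shows "conj (x + y) = conj x + conj y" "conj (r *\<^sub>R x) = r *\<^sub>R conj x"
    "conj (0 :: quat) = 0" "conj (1 :: quat) = 1"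
  by (simp_all add: conj_cd_def cd_eq_iff cd_sel_simps) (simp_all add: zero_cd_def one_cd_def)

text \<open>The product is unfolded by one doubling only. Quaternion products stay folded, so the
  octonion laws reduce to the quaternion laws already established.\<close>

lemma octo_mult_sel:
  fixes x y :: octo
  shows "cd_fst (x * y) = cd_fst x * cd_fst y - conj (cd_snd y) * cd_snd x"
    "cd_snd (x * y) = cd_snd y * cd_fst x + cd_snd x * conj (cd_fst y)"
    "cd_fst (1 :: octo) = 1" "cd_snd (1 :: octo) = 0"
  by (simp_all add: times_cd_def[where 'a = quat] one_cd_def[where 'a = quat])

interpretation octo: composition_algebra "TYPE(octo)"
proof
  show "\<exists>K. \<forall>a b :: octo. norm (a * b) \<le> norm a * norm b * K"
    by (intro exI[of _ 1]) (simp add: norm_mult_octo)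
  show "(a + a') * b = a * b + a' * b" "a * (b + b') = a * b + a * b'"
    "(r *\<^sub>R a) * b = r *\<^sub>R (a * b)" "a * (r *\<^sub>R b) = r *\<^sub>R (a * b)" for a a' b b' :: octo and r
    by (simp_all add: cd_eq_iff[where 'a = quat] cd_sel_simps octo_mult_sel conj_quat_simps
        quat.mult.add_left quat.mult.add_right quat.mult.scaleR_left quat.mult.scaleR_right
        scaleR_add_right scaleR_diff_right)
  show "1 * x = x" "x * 1 = x" for x :: octo
    by (simp_all add: cd_eq_iff[where 'a = quat] octo_mult_sel conj_quat_simps quat.mult_1_left
        quat.mult_1_right quat.mult.zero_left quat.mult.zero_right)
qed (simp_all add: norm_mult_octo DIM_octo)

theorem proposition3p10:
  shows
    "(\<forall>(\<Omega> :: quat set) (f :: quat \<Rightarrow> quat \<times> quat).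
        slice_domain \<Omega> \<longrightarrow> slice_regular_curve \<Omega> f \<longrightarrow> inj_on f \<Omega> \<longrightarrow>
          parameterized_hypercomplex_Riemann_manifold TYPE(quat) (f ` \<Omega>) \<and>
          slice_conformal_parameterization \<Omega> f) \<and>
     (\<forall>(\<Omega> :: quat set) (g :: quat \<Rightarrow> quat).
        slice_domain \<Omega> \<longrightarrow> slice_regular_on \<Omega> g \<longrightarrow>
          parameterized_hypercomplex_Riemann_manifold TYPE(quat) {(q, g q) | q. q \<in> \<Omega>}) \<and>
     (\<forall>(\<Omega> :: octo set) (f :: octo \<Rightarrow> octo \<times> octo).
        slice_domain \<Omega> \<longrightarrow> slice_regular_curve \<Omega> f \<longrightarrow> inj_on f \<Omega> \<longrightarrow>
          parameterized_hypercomplex_Riemann_manifold TYPE(octo) (f ` \<Omega>) \<and>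
          slice_conformal_parameterization \<Omega> f) \<and>
     (\<forall>(\<Omega> :: octo set) (g :: octo \<Rightarrow> octo).
        slice_domain \<Omega> \<longrightarrow> slice_regular_on \<Omega> g \<longrightarrow>
          parameterized_hypercomplex_Riemann_manifold TYPE(octo) {(q, g q) | q. q \<in> \<Omega>})"
proof (intro conjI allI impI)
  fix \<Omega> and f :: "quat \<Rightarrow> quat \<times> quat"
  assume "slice_domain \<Omega>" "slice_regular_curve \<Omega> f" "inj_on f \<Omega>"
  then show "slice_conformal_parameterization \<Omega> f"
    by (rule quat.slice_regular_curve_parameterization)
  then show "parameterized_hypercomplex_Riemann_manifold TYPE(quat) (f ` \<Omega>)"
    unfolding parameterized_hypercomplex_Riemann_manifold_def by blast
next
  fix \<Omega> and f :: "octo \<Rightarrow> octo \<times> octo"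
  assume "slice_domain \<Omega>" "slice_regular_curve \<Omega> f" "inj_on f \<Omega>"
  then show "slice_conformal_parameterization \<Omega> f"
    by (rule octo.slice_regular_curve_parameterization)
  then show "parameterized_hypercomplex_Riemann_manifold TYPE(octo) (f ` \<Omega>)"
    unfolding parameterized_hypercomplex_Riemann_manifold_def by blast
qed (auto intro: quat.slice_regular_graph_manifold octo.slice_regular_graph_manifold)

end
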